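(* Consider the convex problem $$\min_{u\in\mathbb{C}^n,\,z\in\mathbb{C}^{Jn},\,p\in\mathbb{C}^{2n}}\ \lambda\|p\|_1+\sum_{j\in\Gamma}\Big(g_j-\sqrt{|z_j|^2+\delta_j}\Big)^2+\eta\sum_{j\in\Omega}|z_j-\hat z_j|^2+\sum_{j\in\Gamma}\mathbb{I}_{H_j}(z_j)\quad\text{subject to } z=Au,\ p=\nabla u, \qquad (P)$$ with the data described in the context. Let $\alpha,\gamma>0$, let $S_1,S_2,S_3$ be self-adjoint positive semidefinite operators on $\mathbb{C}^n,\mathbb{C}^{Jn},\mathbb{C}^{2n}$ respectively, and let $\{(u^k,z^k,p^k,w^k,q^k)\}_{k\ge 0}$ be the sequence generated from an arbitrary starting point $(u^0,z^0,p^0,w^0,q^0)\in\mathbb{C}^n\times\mathbb{C}^{Jn}\times\mathbb{C}^{2n}\times\mathbb{C}^{Jn}\times\mathbb{C}^{2n}$ by the modified semi-proximal ADMM iteration $$\begin{aligned} u^{k+1}&=\arg\min_{u\in\mathbb{C}^n}\ \operatorname{Re}\langle z^k-Au,w^k\rangle+\operatorname{Re}\langle p^k-\nabla u,q^k\rangle+\tfrac{\alpha}{2}\|z^k-Au\|^2+\tfrac{\gamma}{2}\|p^k-\nabla u\|^2+\|u-u^k\|_{S_1}^2,\\ z^{k+1}&=\arg\min_{z\in\mathbb{C}^{Jn}}\ \sum_{j\in\Gamma}\Big(g_j-\sqrt{|z_j|^2+\delta_j}\Big)^2+\sum_{j\in\Gamma}\mathbb{I}_{H_j}(z_j)+\eta\sum_{j\in\Omega}|z_j-\hat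 z_j|^2\\ &\qquad\qquad+\operatorname{Re}\langle z-Au^{k+1},w^k\rangle+\tfrac{\alpha}{2}\|z-Au^{k+1}\|^2+\|z-z^k\|_{S_2}^2,\\ p^{k+1}&=\arg\min_{p\in\mathbb{C}^{2n}}\ \lambda\|p\|_1+\operatorname{Re}\langle p-\nabla u^{k+1},q^k\rangle+\tfrac{\gamma}{2}\|p-\nabla u^{k+1}\|^2+\|p-p^k\|_{S_3}^2,\\ w^{k+1}&=w^k+\tau\alpha\,(z^{k+1}-Au^{k+1}),\\ q^{k+1}&=q^k+\tau\gamma\,(p^{k+1}-\nabla u^{k+1}). \end{aligned}$$ Suppose that $S_1$ is positive definite. If $\tau\in\big(0,(1+\sqrt5)/2\big)$, then the sequence $(u^k,z^k,p^k,w^k,q^k)$ converges to a point $(u^\infty,z^\infty,p^\infty,w^\infty,q^\infty)$ such that $(u^\infty,z^\infty,p^\infty)$ is an optimal solution of $(P)$.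
   Context: Inner products on $\mathbb{C}^K$ are $\langle\mu,\nu\rangle=\sum_j\mu_j\bar\nu_j$; $\|\cdot\|$ is the induced $\ell^2$-norm; $\|\mu\|_S^2=\langle\mu,S\mu\rangle$ for a Hermitian positive semidefinite $S$; $\|\mu\|_1=\sum_j|\mu_j|$ (complex modulus). $\mathbb{I}_H$ is the indicator function of the set $H$ ($0$ on $H$, $+\infty$ outside). Data: $n=n_1n_2$, $J\ge1$, $\Omega=\{1,\dots,Jn\}$, $\Gamma\subseteq\Omega$; $A:\mathbb{C}^n\to\mathbb{C}^{Jn}$ is a linear operator (masked Fourier measurements being the motivating example); $g_j\in\mathbb{R}$ and $\delta_j>0$ for $j\in\Gamma$; $\lambda,\eta>0$; $\hat u\in\mathbb{C}^n$ is a fixed vector (the initial point) and $\hat z=A\hat u$. Discrete gradient: a vector $u\in\mathbb{C}^n$ is identified with an $n_1\times n_2$ array $U$ via $u_{j+(k-1)n_1}=U_{j,k}$. Put $(\nabla_xU)_{j,k}=U_{j+1,k}-U_{j,k}$ for $1\le j\le n_1-1$ and $0$ for $j=n_1$; $(\nabla_yU)_{j,k}=U_{j,k+1}-U_{j,k}$ for $1\le k\le n_2-1$ and $0$ for $k=n_2$. Then $\nabla u\in\mathbb{C}^{2n}$ is the stacking of the vectorizations of $\nabla_xU$ and $\nabla_yU$. Sets $H_j$ ($j\in\Gamma$): if $g_j\le0$, $H_j=\mathbb{C}$. If $g_j>0$, let $R_j=\frac{2g_j}{\sqrt3(1+\eta)}$; it is assumed that $|\hat z_j|>R_j$, and $H_j$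 is the closed half-plane $H_j=\{\zeta\in\mathbb{C}:\operatorname{Re}(\zeta\,\overline{\hat z_j})/|\hat z_j|\ge R_j+s_j\}$, bounded by the tangent line to the disk $\{|\zeta|\le R_j\}$ at the projection of $\hat z_j$ onto it, shifted by a small amount $s_j$ towards $\hat z_j$, with $0\le s_j\le|\hat z_j|-R_j$. In particular $\hat z_j\in H_j$. On $H_j$ the function $\zeta\mapsto(g_j-\sqrt{|\zeta|^2+\delta_j})^2+\eta|\zeta-\hat z_j|^2$ is convex. *)

theory Defs
  imports "HOL-Analysis.Analysis"
begin

text \<open>
  An $n_1 \times n_2$ array is a vector indexed by \<^typ>\<open>'r \<times> 'c\<close>, where \<^typ>\<open>'r\<close> and \<^typ>\<open>'c\<close>
  are finite linear orders with $n_1$ and $n_2$ elements. The index set $\Omega$ of the measurements,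
  of size $J n_1 n_2$, is all of \<^typ>\<open>'j \<times> 'r \<times> 'c\<close> with $J$ the cardinality of \<^typ>\<open>'j\<close>, and
  $\mathbb{C}^{2n}$ is indexed by a sum type, its left summand carrying the $x$-differences.
  The library norm of \<^typ>\<open>complex ^ 'i\<close> is the $\ell^2$-norm.
\<close>

definition cinner :: "complex ^ 'i::finite \<Rightarrow> complex ^ 'i \<Rightarrow> complex" where
  "cinner \<mu> \<nu> = (\<Sum>i\<in>UNIV. \<mu> $ i * cnj (\<nu> $ i))"

definition l1_norm :: "complex ^ 'i::finite \<Rightarrow> real" where
  "l1_norm \<mu> = (\<Sum>i\<in>UNIV. cmod (\<mu> $ i))"

definition complex_linear :: "(complex ^ 'a::finite \<Rightarrow> complex ^ 'b::finite) \<Rightarrow> bool" where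
  "complex_linear T \<longleftrightarrow> Vector_Spaces.linear (*s) (*s) T"

definition self_adjoint :: "(complex ^ 'i::finite \<Rightarrow> complex ^ 'i) \<Rightarrow> bool" where
  "self_adjoint S \<longleftrightarrow> complex_linear S \<and> (\<forall>x y. cinner (S x) y = cinner x (S y))"

text \<open>For self-adjoint \<open>S\<close> the number \<open>cinner x (S x)\<close> is real, so taking its real part below loses
  nothing.\<close>

definition pos_semidef :: "(complex ^ 'i::finite \<Rightarrow> complex ^ 'i) \<Rightarrow> bool" where
  "pos_semidef S \<longleftrightarrow> self_adjoint S \<and> (\<forall>x. 0 \<le> Re (cinner x (S x)))"

definition pos_def :: "(complex ^ 'i::finite \<Rightarrow> complex ^ 'i) \<Rightarrow> bool" where
  "pos_def S \<longleftrightarrow> self_adjoint S \<and> (\<forall>x. x \<noteq> 0 \<longrightarrow> 0 < Re (cinner x (S x)))"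

definition seminorm_sq :: "(complex ^ 'i::finite \<Rightarrow> complex ^ 'i) \<Rightarrow> complex ^ 'i \<Rightarrow> real" where
  "seminorm_sq S \<mu> = Re (cinner \<mu> (S \<mu>))"

text \<open>The successor of a non-maximal index is the least larger index.\<close>

definition next_index :: "'a::{finite,linorder} \<Rightarrow> 'a" where
  "next_index i = Min {i<..}"

definition grad_x ::
  "complex ^ ('r::{finite,linorder} \<times> 'c::finite) \<Rightarrow> complex ^ ('r \<times> 'c)" where
  "grad_x U = (\<chi> i. case i of (j, k) \<Rightarrow>
     if j = Max UNIV then 0 else U $ (next_index j, k) - U $ (j, k))"

definition grad_y ::
  "complex ^ ('r::finite \<times> 'c::{finite,linorder}) \<Rightarrow> complex ^ ('r \<times> 'c)" where
  "grad_y U = (\<chi> i. case i of (j, k) \<Rightarrow>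
     if k = Max UNIV then 0 else U $ (j, next_index k) - U $ (j, k))"

definition grad ::
  "complex ^ ('r::{finite,linorder} \<times> 'c::{finite,linorder}) \<Rightarrow> complex ^ ('r \<times> 'c + 'r \<times> 'c)"
  where
  "grad U = (\<chi> i. case i of Inl a \<Rightarrow> grad_x U $ a | Inr b \<Rightarrow> grad_y U $ b)"

definition radius :: "real \<Rightarrow> real \<Rightarrow> real" where
  "radius \<eta> g = 2 * g / (sqrt 3 * (1 + \<eta>))"

text \<open>The arguments \<open>g\<close>, \<open>s\<close>, \<open>zh\<close> are the entries $g_j$, $s_j$, $\hat z_j$ at a single index.\<close>

definition half_plane :: "real \<Rightarrow> real \<Rightarrow> real \<Rightarrow> complex \<Rightarrow> complex set" where
  "half_plane \<eta> g s zh =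
     (if g \<le> 0 then UNIV else {\<zeta>. Re (\<zeta> * cnj zh) / cmod zh \<ge> radius \<eta> g + s})"

definition cvx_indicator :: "'a set \<Rightarrow> 'a \<Rightarrow> ereal" where
  "cvx_indicator H x = (if x \<in> H then 0 else \<infinity>)"

text \<open>The part of the objective that depends on \<open>z\<close>, shared by the problem and the \<open>z\<close>-step.\<close>

definition z_cost ::
  "'i::finite set \<Rightarrow> ('i \<Rightarrow> real) \<Rightarrow> ('i \<Rightarrow> real) \<Rightarrow> ('i \<Rightarrow> real) \<Rightarrow> real \<Rightarrow> complex ^ 'i \<Rightarrow> complex ^ 'i \<Rightarrow> ereal"
  where
  "z_cost \<Gamma> g \<delta> s \<eta> zhat z =
     ereal ((\<Sum>j\<in>\<Gamma>. (g j - sqrt ((cmod (z $ j))\<^sup>2 + \<delta> j))\<^sup>2)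
            + \<eta> * (\<Sum>j\<in>UNIV. (cmod (z $ j - zhat $ j))\<^sup>2))
     + (\<Sum>j\<in>\<Gamma>. cvx_indicator (half_plane \<eta> (g j) (s j) (zhat $ j)) (z $ j))"

end

theory Submission
  imports Defs
begin

text \<open>
  In the scaled variable $y = (\sqrt\alpha z, \sqrt\gamma p)$ the scheme is a two-block semi-proximal
  ADMM for minimising $\varphi(y)$ over a closed convex set subject to $y = Bu$. For a KKT point
  $(u^*, w^*)$ the weighted squared distance of the iterates to it, corrected by
  $\|y^{k+1}-y^k\|_T^2$ and a multiple of $\|y^{k+1}-Bu^{k+1}\|^2$, decreases by at least a multiple of
  the squared increments; the cross term left over can be absorbed because
  $1 + \tau - \tau^2 > 0$. The iterates are therefore bounded, any cluster point is again a KKT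
  point, and using that point as the reference makes the whole sequence converge to it.

  KKT points exist because $2\hat z = A(2\hat u)$ is a Slater point: the strict epigraph of $\varphi$ can be
  separated from $\mathrm{range}(B) \times \{\min\varphi\}$ by a non-vertical hyperplane. Convexity of the cost
  on the half-planes follows from the quadratic upper bound on $\sqrt{|\zeta|^2+\delta}$ at points
  with $(1+\eta)|\zeta| \ge g$.
\<close>

section \<open>Convergence of the semi-proximal ADMM\<close>

lemma pos_def_lower_bound:
  fixes S :: "'a::euclidean_space \<Rightarrow> 'a"
  assumes lin: "linear S" and pos: "\<And>x. x \<noteq> 0 \<Longrightarrow> 0 < x \<bullet> S x"
  obtains m where "m > 0" "\<And>x. m * (norm x)\<^sup>2 \<le> x \<bullet> S x"
proof -
  have "continuous_on (sphere 0 1) (\<lambda>x. x \<bullet> S x)"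
    using lin by (intro continuous_intros linear_continuous_on) (simp add: linear_conv_bounded_linear)
  then obtain a where a: "a \<in> sphere 0 1" "\<And>x. x \<in> sphere 0 1 \<Longrightarrow> a \<bullet> S a \<le> x \<bullet> S x"
    using continuous_attains_inf[of "sphere (0::'a) 1"] by fastforce
  have "a \<bullet> S a * (norm x)\<^sup>2 \<le> x \<bullet> S x" for x
  proof (cases "x = 0")
    case False
    let ?e = "x /\<^sub>R norm x"
    have "a \<bullet> S a \<le> ?e \<bullet> S ?e"
      using False by (intro a(2)) simp
    also have "\<dots> = x \<bullet> S x / (norm x)\<^sup>2"
      by (simp add: linear_scale[OF lin] power2_eq_square divide_inverse)
    finally show ?thesis
      using False by (simp add: field_simps)
  qed (simp add: linear_0[OF lin])
  moreover have "a \<bullet> S a > 0"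
    using a(1) by (intro pos) auto
  ultimately show ?thesis
    using that by blast
qed

text \<open>Turns the product of an increment with the current error into a difference of squared
  errors plus a squared increment, which is what makes the energy estimate telescope.\<close>

lemma symmetric_polarization:
  fixes T :: "'a::real_inner \<Rightarrow> 'a"
  assumes lin: "linear T" and sym: "\<And>x y. T x \<bullet> y = x \<bullet> T y"
  shows "2 * (T (a - b) \<bullet> a) = a \<bullet> T a - b \<bullet> T b + (a - b) \<bullet> T (a - b)"
  using sym[of b a] inner_commute[of a "T b"] inner_commute[of a "T a"]
  by (simp add: linear_diff[OF lin] inner_diff_left inner_diff_right)

lemma symmetric_psd_Young:
  fixes T :: "'a::real_inner \<Rightarrow> 'a"
  assumes lin: "linear T" and sym: "\<And>x y. T x \<bullet> y = x \<bullet> T y" and psd: "\<And>x. 0 \<le> x \<bullet> T x"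
  shows "2 * (T a \<bullet> b) \<le> a \<bullet> T a + b \<bullet> T b"
  using psd[of "a - b"] sym[of b a] inner_commute[of b "T a"] inner_commute[of a "T b"]
  by (simp add: linear_diff[OF lin] inner_diff_left inner_diff_right)

text \<open>Here the upper bound on \<tau> enters: the cross term has to be paid for by less than
  one \<open>(norm b)\<^sup>2\<close> and by a share of the \<open>2 - \<tau>\<close> available for
  \<open>(norm a)\<^sup>2\<close>, with \<kappa> of each left over.\<close>

lemma golden_ratio_Young:
  fixes \<tau> :: real
  assumes "\<tau> \<in> {0<..<(1 + sqrt 5) / 2}"
  obtains \<mu> \<kappa> :: real where "\<kappa> > 0" "\<mu> \<ge> 0" "\<mu> + \<kappa> \<le> 2 - \<tau>"
    "\<And>a b :: 'a::real_inner. 2 * (1 - \<tau>) * (a \<bullet> b) \<le> \<mu> * (norm a)\<^sup>2 + (1 - \<kappa>) * (norm b)\<^sup>2"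
proof (cases "\<tau> \<le> 1")
  case True
  show ?thesis
  proof (rule that[of \<tau> "1 - \<tau>"])
    fix a b :: 'a
    have "2 * (a \<bullet> b) \<le> (norm a)\<^sup>2 + (norm b)\<^sup>2"
      using zero_le_power2[of "norm (a - b)"]
      by (simp add: power2_norm_eq_inner inner_diff_left inner_diff_right inner_commute)
    then have "(1 - \<tau>) * (2 * (a \<bullet> b)) \<le> (1 - \<tau>) * ((norm a)\<^sup>2 + (norm b)\<^sup>2)"
      using True by (intro mult_left_mono) auto
    then show "2 * (1 - \<tau>) * (a \<bullet> b) \<le> (1 - \<tau>) * (norm a)\<^sup>2 + (1 - \<tau>) * (norm b)\<^sup>2"
      by (simp add: algebra_simps)
  qed (use assms True in auto)
next
  case False
  \<comment> \<open>Completing the square: this is four times the wanted inequality, and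
    \<open>2 * \<tau> - 1\<close> is nonnegative because \<open>\<tau> > 1\<close>.\<close>
  have "(2 * \<tau> - 1)\<^sup>2 < (sqrt 5)\<^sup>2"
    using assms False by (intro power_strict_mono) auto
  then have gold: "1 + \<tau> - \<tau>\<^sup>2 > 0"
    by (simp add: power2_eq_square algebra_simps)
  have "(1 + \<tau> - \<tau>\<^sup>2) / \<tau> \<le> (1 + \<tau> - \<tau>\<^sup>2) / 1"
    using gold False by (intro divide_left_mono) auto
  then have \<kappa>: "(1 + \<tau> - \<tau>\<^sup>2) / \<tau> \<le> 1 - \<tau> * (\<tau> - 1)"
    by (simp add: power2_eq_square algebra_simps)
  show ?thesis
  proof (rule that[of "(1 + \<tau> - \<tau>\<^sup>2) / \<tau>" "(\<tau> - 1) / \<tau>"])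
    show "(\<tau> - 1) / \<tau> + (1 + \<tau> - \<tau>\<^sup>2) / \<tau> \<le> 2 - \<tau>"
      using False by (simp add: field_simps power2_eq_square)
    fix a b :: 'a
    \<comment> \<open>The weight \<tau> on \<open>b\<close> is chosen so that, after multiplication
      by \<open>(\<tau> - 1) / \<tau>\<close>, the cross term is exactly the required one;
      \<open>\<mu> + \<kappa> = 2 - \<tau>\<close> then holds with equality.\<close>
    have "0 \<le> (norm (a + \<tau> *\<^sub>R b))\<^sup>2"
      by simp
    also have "\<dots> = (norm a)\<^sup>2 + 2 * \<tau> * (a \<bullet> b) + \<tau>\<^sup>2 * (norm b)\<^sup>2"
      unfolding power2_norm_eq_inner
      by (simp add: inner_add_left inner_add_right inner_commute power2_eq_square)
    finally have "0 \<le> ((\<tau> - 1) / \<tau>) * ((norm a)\<^sup>2 + 2 * \<tau> * (a \<bullet> b) + \<tau>\<^sup>2 * (norm b)\<^sup>2)"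
      using False by (intro mult_nonneg_nonneg) auto
    also have "\<dots> = (\<tau> - 1) / \<tau> * (norm a)\<^sup>2 + 2 * (\<tau> - 1) * (a \<bullet> b) + \<tau> * (\<tau> - 1) * (norm b)\<^sup>2"
      using False by (simp add: field_simps power2_eq_square)
    finally have "2 * (1 - \<tau>) * (a \<bullet> b) \<le> (\<tau> - 1) / \<tau> * (norm a)\<^sup>2 + \<tau> * (\<tau> - 1) * (norm b)\<^sup>2"
      by (simp add: algebra_simps)
    also have "\<tau> * (\<tau> - 1) * (norm b)\<^sup>2 \<le> (1 - (1 + \<tau> - \<tau>\<^sup>2) / \<tau>) * (norm b)\<^sup>2"
      using \<kappa> by (intro mult_right_mono) auto
    finally show "2 * (1 - \<tau>) * (a \<bullet> b)
        \<le> (\<tau> - 1) / \<tau> * (norm a)\<^sup>2 + (1 - (1 + \<tau> - \<tau>\<^sup>2) / \<tau>) * (norm b)\<^sup>2"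
      by simp
  qed (use gold False in auto)
qed

lemma tendsto_zero_if_power2_le:
  fixes f :: "nat \<Rightarrow> 'a::real_normed_vector"
  assumes b: "b \<longlonglongrightarrow> 0" and c: "c > 0" and le: "\<And>k. c * (norm (f k))\<^sup>2 \<le> b k"
  shows "f \<longlonglongrightarrow> 0"
proof -
  have "(\<lambda>k. b k / c) \<longlonglongrightarrow> 0"
    using tendsto_divide[OF b tendsto_const, of c] c by simp
  then have "(\<lambda>k. (norm (f k))\<^sup>2) \<longlonglongrightarrow> 0"
  proof (rule tendsto_sandwich[OF _ _ tendsto_const, rotated 2])
    show "\<forall>\<^sub>F k in sequentially. (norm (f k))\<^sup>2 \<le> b k / c"
      using le c by (simp add: pos_le_divide_eq mult.commute)
  qed simp
  then have "(\<lambda>k. sqrt ((norm (f k))\<^sup>2)) \<longlonglongrightarrow> sqrt 0"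
    by (rule tendsto_real_sqrt)
  then show ?thesis
    by (simp add: tendsto_norm_zero_iff)
qed

text \<open>Both penalties have been scaled to \<open>1\<close> and the factor \<open>2\<close> from differentiating the proximal terms
  is absorbed in \<open>S\<close> and \<open>T\<close>; the minimisation steps enter only through their optimality
  conditions.\<close>

locale semi_proximal_admm =
  fixes B :: "'x::euclidean_space \<Rightarrow> 'y::euclidean_space"
    and S :: "'x \<Rightarrow> 'x" and T :: "'y \<Rightarrow> 'y"
    and C :: "'y set" and \<phi> :: "'y \<Rightarrow> real"
    and u :: "nat \<Rightarrow> 'x" and y w :: "nat \<Rightarrow> 'y" and \<tau> :: real
  assumes B: "linear B"
    and S: "linear S" and S_sym: "\<And>x x'. S x \<bullet> x' = x \<bullet> S x'"
    and S_pos: "\<And>x. x \<noteq> 0 \<Longrightarrow> 0 < x \<bullet> S x"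
    and T: "linear T" and T_sym: "\<And>x x'. T x \<bullet> x' = x \<bullet> T x'" and T_psd: "\<And>x. 0 \<le> x \<bullet> T x"
    and C: "closed C" and \<phi>: "continuous_on C \<phi>"
    and u_opt: "\<And>k v. (w k + y k - B (u (Suc k))) \<bullet> B v = S (u (Suc k) - u k) \<bullet> v"
    and y_in: "\<And>k. y (Suc k) \<in> C"
    and y_opt: "\<And>k c. c \<in> C \<Longrightarrow> \<phi> (y (Suc k)) \<le> \<phi> c +
      (w k + (y (Suc k) - B (u (Suc k))) + T (y (Suc k) - y k)) \<bullet> (c - y (Suc k))"
    and w_step: "\<And>k. w (Suc k) = w k + \<tau> *\<^sub>R (y (Suc k) - B (u (Suc k)))"
    and \<tau>: "\<tau> \<in> {0<..<(1 + sqrt 5) / 2}"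
begin

text \<open>Saddle point conditions for the Lagrangian
  \<open>\<phi> y + ws \<bullet> (y - B u)\<close>: stationarity in \<open>u\<close>, and minimality
  in \<open>y\<close> over \<open>C\<close> at \<open>B us\<close>. The term
  \<open>ws \<bullet> B us\<close> is missing from the last clause because it is zero by the
  second.\<close>

definition kkt :: "'x \<Rightarrow> 'y \<Rightarrow> bool" where
  "kkt us ws \<longleftrightarrow> B us \<in> C \<and> (\<forall>v. ws \<bullet> B v = 0) \<and> (\<forall>c\<in>C. \<phi> (B us) \<le> \<phi> c + ws \<bullet> c)"

definition r :: "nat \<Rightarrow> 'y" where "r k = y k - B (u k)"

definition dy :: "nat \<Rightarrow> 'y" where "dy k = y (Suc k) - y k"

definition du :: "nat \<Rightarrow> 'x" where "du k = u (Suc k) - u k"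

definition energy :: "'x \<Rightarrow> 'y \<Rightarrow> nat \<Rightarrow> real" where
  "energy us ws k = (norm (w k - ws))\<^sup>2 / \<tau> + (norm (y k - B us))\<^sup>2
     + (y k - B us) \<bullet> T (y k - B us) + (u k - us) \<bullet> S (u k - us)"

section \<open>Decrease of the distance to a KKT point\<close>

lemma tau_pos: "\<tau> > 0"
  using \<tau> by simp

lemma S_psd: "0 \<le> x \<bullet> S x"
  using S_pos[of x] by (cases "x = 0") (auto simp: linear_0[OF S])

text \<open>The \<open>y\<close>-optimality tested at \<open>B us\<close> and the KKT inequality
  tested at \<open>y (Suc k)\<close> add up to an inequality free of \<open>\<phi>\<close>. Combined
  with the \<open>u\<close>-optimality tested at the error \<open>ue\<close>, it consists of
  products of increments with errors, each of which polarization turns into a difference of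
  squares.\<close>

lemma energy_step:
  assumes "kkt us ws"
  shows "energy us ws (Suc k) + (2 - \<tau>) * (norm (r (Suc k)))\<^sup>2 + (norm (dy k))\<^sup>2
      + dy k \<bullet> T (dy k) + du k \<bullet> S (du k) - 2 * (dy k \<bullet> r (Suc k)) \<le> energy us ws k"
proof -
  define ye where "ye = y (Suc k) - B us"
  define ue where "ue = u (Suc k) - us"
  define we where "we = w k - ws"
  define R where "R = r (Suc k)"
  have orth: "ws \<bullet> B v = 0" for v
    using assms by (simp add: kkt_def)
  have ye: "ye = R + B ue"
    by (simp add: ye_def ue_def R_def r_def linear_diff[OF B])
  have "\<phi> (y (Suc k)) \<le> \<phi> (B us) + (w k + R + T (dy k)) \<bullet> (- ye)"
    using y_opt[of "B us" k] assms by (simp add: kkt_def ye_def R_def r_def dy_def)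
  moreover have "\<phi> (B us) \<le> \<phi> (y (Suc k)) + ws \<bullet> ye"
    using assms y_in[of k] by (simp add: kkt_def ye_def inner_diff_right)
  ultimately have 1: "(we + R + T (dy k)) \<bullet> ye \<le> 0"
    by (simp add: we_def inner_add_left inner_diff_left)
  \<comment> \<open>The \<open>u\<close>-step sees the old \<open>y k\<close>; replacing it by
    \<open>y (Suc k)\<close> costs \<open>dy k\<close>, the origin of the cross term
    \<open>dy k \<bullet> r (Suc k)\<close>.\<close>
  have "(w k + y k - B (u (Suc k))) = we + ws + R - dy k"
    by (simp add: we_def R_def r_def dy_def)
  then have 2: "(we + R - dy k) \<bullet> B ue = S (du k) \<bullet> ue"
    using u_opt[of k ue] orth by (simp add: du_def inner_add_left inner_diff_left)
  have 3: "we \<bullet> R + (norm R)\<^sup>2 + T (dy k) \<bullet> ye + S (du k) \<bullet> ue + dy k \<bullet> ye - dy k \<bullet> R \<le> 0"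
    using 1 2 unfolding ye
    by (simp add: power2_norm_eq_inner inner_add_left inner_diff_left inner_add_right)
  have Te: "2 * (T (dy k) \<bullet> ye) = ye \<bullet> T ye - (y k - B us) \<bullet> T (y k - B us) + dy k \<bullet> T (dy k)"
    using symmetric_polarization[OF T T_sym, of ye "y k - B us"] by (simp add: ye_def dy_def)
  have Se: "2 * (S (du k) \<bullet> ue) = ue \<bullet> S ue - (u k - us) \<bullet> S (u k - us) + du k \<bullet> S (du k)"
    using symmetric_polarization[OF S S_sym, of ue "u k - us"] by (simp add: ue_def du_def)
  have Ye: "2 * (dy k \<bullet> ye) = (norm ye)\<^sup>2 - (norm (y k - B us))\<^sup>2 + (norm (dy k))\<^sup>2"
    using symmetric_polarization[of "\<lambda>x::'y. x" ye "y k - B us"]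
    by (simp add: ye_def dy_def power2_norm_eq_inner linear_id[unfolded id_def])
  have "w (Suc k) - ws = we + \<tau> *\<^sub>R R"
    by (simp add: we_def R_def r_def w_step)
  then have We: "2 * (we \<bullet> R) = (norm (w (Suc k) - ws))\<^sup>2 / \<tau> - (norm we)\<^sup>2 / \<tau> - \<tau> * (norm R)\<^sup>2"
    using tau_pos
    by (simp add: power2_norm_eq_inner inner_add_left inner_add_right inner_commute field_simps)
  have "energy us ws (Suc k) = (norm (w (Suc k) - ws))\<^sup>2 / \<tau> + (norm ye)\<^sup>2 + ye \<bullet> T ye + ue \<bullet> S ue"
    by (simp add: energy_def ye_def ue_def)
  moreover have "energy us ws k = (norm we)\<^sup>2 / \<tau> + (norm (y k - B us))\<^sup>2
      + (y k - B us) \<bullet> T (y k - B us) + (u k - us) \<bullet> S (u k - us)"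
    by (simp add: energy_def we_def)
  ultimately show ?thesis
    using 3 Te Se Ye We unfolding R_def[symmetric] left_diff_distrib by linarith
qed

text \<open>Monotonicity of the subdifferential of \<open>\<phi>\<close> at two consecutive iterates controls the cross term
  of \<open>energy_step\<close>.\<close>

lemma cross_term_le:
  "2 * (dy (Suc k) \<bullet> r (Suc (Suc k))) \<le> 2 * (1 - \<tau>) * (r (Suc k) \<bullet> dy (Suc k))
     - dy (Suc k) \<bullet> T (dy (Suc k)) + dy k \<bullet> T (dy k)"
proof -
  let ?d = "dy (Suc k)"
  have "\<phi> (y (Suc (Suc k))) \<le> \<phi> (y (Suc k)) + (w (Suc k) + r (Suc (Suc k)) + T ?d) \<bullet> (- ?d)"
    using y_opt[OF y_in[of k], of "Suc k"] by (simp add: r_def dy_def)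
  moreover have "\<phi> (y (Suc k)) \<le> \<phi> (y (Suc (Suc k))) + (w k + r (Suc k) + T (dy k)) \<bullet> ?d"
    using y_opt[OF y_in[of "Suc k"], of k] by (simp add: r_def dy_def)
  \<comment> \<open>In the sum of the two inequalities the multipliers leave \<open>- \<tau>\<close>
    times the old residual, so its total coefficient becomes \<open>1 - \<tau>\<close>.\<close>
  moreover have "w (Suc k) = w k + \<tau> *\<^sub>R r (Suc k)"
    by (simp add: w_step r_def)
  ultimately have "r (Suc (Suc k)) \<bullet> ?d \<le> (1 - \<tau>) * (r (Suc k) \<bullet> ?d) - ?d \<bullet> T ?d + T (dy k) \<bullet> ?d"
    by (simp add: inner_add_left inner_commute algebra_simps)
  with symmetric_psd_Young[OF T T_sym T_psd, of "dy k" ?d] show ?thesis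
    by (simp add: inner_commute algebra_simps)
qed

text \<open>The two corrections are the terms of the previous step that bounding the cross term
  leaves on the right-hand side. The energy is taken at \<open>Suc k\<close> because two generated
  iterates are compared, and \<open>y 0\<close> may lie outside \<open>C\<close>.\<close>

definition lyapunov :: "real \<Rightarrow> 'x \<Rightarrow> 'y \<Rightarrow> nat \<Rightarrow> real" where
  "lyapunov \<mu> us ws k = energy us ws (Suc k) + dy k \<bullet> T (dy k) + \<mu> * (norm (r (Suc k)))\<^sup>2"

text \<open>Of the \<open>2 - \<tau>\<close> squared residuals in the energy estimate, \<mu> are
  stored in the new value and \<kappa> survive; of the one squared \<open>dy\<close>, Young's
  inequality consumes \<open>1 - \<kappa>\<close>. The constants depend on neither the reference
  point nor \<open>k\<close>.\<close>

lemma lyapunov_decrease: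
  obtains \<mu> \<kappa> where "\<mu> \<ge> 0" "\<kappa> > 0"
    "\<And>us ws k. kkt us ws \<Longrightarrow> lyapunov \<mu> us ws (Suc k) + \<kappa> * (norm (r (Suc (Suc k))))\<^sup>2
       + \<kappa> * (norm (dy (Suc k)))\<^sup>2 + du (Suc k) \<bullet> S (du (Suc k)) \<le> lyapunov \<mu> us ws k"
proof -
  show ?thesis
  proof (rule golden_ratio_Young[OF \<tau>, where 'a='y])
    fix \<mu> \<kappa> :: real
    assume \<mu>\<kappa>: "\<kappa> > 0" "\<mu> \<ge> 0" "\<mu> + \<kappa> \<le> 2 - \<tau>"
      and young: "\<And>a b :: 'y. 2 * (1 - \<tau>) * (a \<bullet> b) \<le> \<mu> * (norm a)\<^sup>2 + (1 - \<kappa>) * (norm b)\<^sup>2"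
    show ?thesis
    proof (rule that[OF \<mu>\<kappa>(2,1)])
    fix us ws k
    assume kkt: "kkt us ws"
    have "(\<mu> + \<kappa>) * (norm (r (Suc (Suc k))))\<^sup>2 \<le> (2 - \<tau>) * (norm (r (Suc (Suc k))))\<^sup>2"
      using \<mu>\<kappa>(3) by (intro mult_right_mono) auto
    with energy_step[OF kkt, of "Suc k"] cross_term_le[of k] T_psd[of "dy (Suc k)"]
      young[of "r (Suc k)" "dy (Suc k)"]
    show "lyapunov \<mu> us ws (Suc k) + \<kappa> * (norm (r (Suc (Suc k))))\<^sup>2
       + \<kappa> * (norm (dy (Suc k)))\<^sup>2 + du (Suc k) \<bullet> S (du (Suc k)) \<le> lyapunov \<mu> us ws k"
      unfolding lyapunov_def distrib_right left_diff_distrib by linarith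
    qed
  qed
qed

text \<open>All summands are nonnegative, so each is bounded by the whole. Definiteness of
  \<open>S\<close> controls \<open>u\<close>, while \<open>y\<close> is controlled by its
  unit-weight term. Since \<open>K\<close> is uniform in the reference point, it also serves for the
  cluster point found later.\<close>

lemma lyapunov_bounds:
  obtains K where "K > 0"
    "\<And>\<mu> us ws k. \<mu> \<ge> 0 \<Longrightarrow> (norm (u (Suc k) - us))\<^sup>2 + (norm (y (Suc k) - B us))\<^sup>2
       + (norm (w (Suc k) - ws))\<^sup>2 \<le> K * lyapunov \<mu> us ws k"
proof -
  obtain m where m: "m > 0" "\<And>x. m * (norm x)\<^sup>2 \<le> x \<bullet> S x"
    using pos_def_lower_bound[OF S S_pos] by blast
  show ?thesis
  proof (rule that[of "1 / m + 1 + \<tau>"])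
    show "1 / m + 1 + \<tau> > 0"
      using m(1) tau_pos by (simp add: add_pos_pos)
    fix \<mu> us ws k
    assume \<mu>: "\<mu> \<ge> (0::real)"
    define a b c where "a = (u (Suc k) - us) \<bullet> S (u (Suc k) - us)"
      and "b = (norm (y (Suc k) - B us))\<^sup>2" and "c = (norm (w (Suc k) - ws))\<^sup>2 / \<tau>"
    let ?L = "lyapunov \<mu> us ws k"
    have pos: "a \<ge> 0" "b \<ge> 0" "c \<ge> 0"
      using tau_pos S_psd by (auto simp: a_def b_def c_def)
    have "a + b + c \<le> ?L"
      using T_psd \<mu> by (simp add: lyapunov_def energy_def a_def b_def c_def)
    with pos have L: "a \<le> ?L" "b \<le> ?L" "c \<le> ?L"
      by auto
    have "(norm (u (Suc k) - us))\<^sup>2 \<le> 1 / m * a"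
      using m by (simp add: a_def field_simps)
    also have "\<dots> \<le> 1 / m * ?L"
      using m(1) L by (intro mult_left_mono) auto
    finally have 1: "(norm (u (Suc k) - us))\<^sup>2 \<le> 1 / m * ?L" .
    have "\<tau> * c \<le> \<tau> * ?L"
      using tau_pos L by (intro mult_left_mono) auto
    then have "(norm (w (Suc k) - ws))\<^sup>2 \<le> \<tau> * ?L"
      using tau_pos by (simp add: c_def)
    with 1 L(2) show "(norm (u (Suc k) - us))\<^sup>2 + (norm (y (Suc k) - B us))\<^sup>2
       + (norm (w (Suc k) - ws))\<^sup>2 \<le> (1 / m + 1 + \<tau>) * ?L"
      unfolding b_def by (simp add: distrib_right)
  qed
qed

theorem converges_to_kkt:
  assumes "kkt us ws"
  obtains ui wi where "kkt ui wi" "u \<longlonglongrightarrow> ui" "y \<longlonglongrightarrow> B ui" "w \<longlonglongrightarrow> wi"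
proof -
  obtain \<mu> \<kappa> where \<mu>: "\<mu> \<ge> 0" and \<kappa>: "\<kappa> > 0" and decr:
    "\<And>us ws k. kkt us ws \<Longrightarrow> lyapunov \<mu> us ws (Suc k) + \<kappa> * (norm (r (Suc (Suc k))))\<^sup>2
       + \<kappa> * (norm (dy (Suc k)))\<^sup>2 + du (Suc k) \<bullet> S (du (Suc k)) \<le> lyapunov \<mu> us ws k"
    using lyapunov_decrease by blast
  obtain K where K: "K > 0" and "\<And>\<mu> us ws k. \<mu> \<ge> 0 \<Longrightarrow> (norm (u (Suc k) - us))\<^sup>2
       + (norm (y (Suc k) - B us))\<^sup>2 + (norm (w (Suc k) - ws))\<^sup>2 \<le> K * lyapunov \<mu> us ws k"
    using lyapunov_bounds by blast
  note bd = this(2)[OF \<mu>]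
  obtain m where m: "m > 0" "\<And>x. m * (norm x)\<^sup>2 \<le> x \<bullet> S x"
    using pos_def_lower_bound[OF S S_pos] by blast
  have bd_u: "(norm (u (Suc k) - us))\<^sup>2 \<le> K * lyapunov \<mu> us ws k"
    and bd_y: "(norm (y (Suc k) - B us))\<^sup>2 \<le> K * lyapunov \<mu> us ws k"
    and bd_w: "(norm (w (Suc k) - ws))\<^sup>2 \<le> K * lyapunov \<mu> us ws k" for us ws k
    using bd[of k us ws] zero_le_power2[of "norm (u (Suc k) - us)"]
      zero_le_power2[of "norm (y (Suc k) - B us)"] zero_le_power2[of "norm (w (Suc k) - ws)"]
    by linarith+
  have L_pos: "0 \<le> lyapunov \<mu> us ws k" for us ws k
  proof -
    have "0 \<le> K * lyapunov \<mu> us ws k"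
      by (rule order_trans[OF zero_le_power2 bd_u])
    then show ?thesis
      using K by (simp add: zero_le_mult_iff)
  qed
  have dec: "decseq (lyapunov \<mu> us ws)" if "kkt us ws" for us ws
  proof (rule decseq_SucI)
    fix k
    have "0 \<le> \<kappa> * (norm (r (Suc (Suc k))))\<^sup>2" "0 \<le> \<kappa> * (norm (dy (Suc k)))\<^sup>2"
      using \<kappa> by auto
    with decr[OF that, of k] S_psd[of "du (Suc k)"]
    show "lyapunov \<mu> us ws (Suc k) \<le> lyapunov \<mu> us ws k"
      by linarith
  qed
  have conv: "\<exists>l. lyapunov \<mu> us ws \<longlonglongrightarrow> l" if "kkt us ws" for us ws
    by (rule decseq_convergent[OF dec[OF that]]) (use L_pos in auto)
  obtain l where l: "lyapunov \<mu> us ws \<longlonglongrightarrow> l"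
    using conv[OF assms] by blast
  \<comment> \<open>Consecutive differences of a convergent sequence vanish in the limit and
    dominate the squared residuals and increments.\<close>
  define gap where "gap k = lyapunov \<mu> us ws k - lyapunov \<mu> us ws (Suc k)" for k
  have gap: "gap \<longlonglongrightarrow> 0"
    unfolding gap_def using tendsto_diff[OF l LIMSEQ_Suc[OF l]] by simp
  have gap_le: "\<kappa> * (norm (r (Suc (Suc k))))\<^sup>2 + \<kappa> * (norm (dy (Suc k)))\<^sup>2
      + m * (norm (du (Suc k)))\<^sup>2 \<le> gap k" for k
    using decr[OF assms, of k] m(2)[of "du (Suc k)"] unfolding gap_def by linarith
  have nn: "0 \<le> \<kappa> * (norm x)\<^sup>2" "0 \<le> m * (norm x')\<^sup>2" for x :: 'y and x' :: 'x
    using \<kappa> m(1) by auto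
  have r0: "r \<longlonglongrightarrow> 0"
  proof (rule LIMSEQ_imp_Suc, rule LIMSEQ_imp_Suc, rule tendsto_zero_if_power2_le[OF gap \<kappa>])
    show "\<kappa> * (norm (r (Suc (Suc k))))\<^sup>2 \<le> gap k" for k
      using gap_le[of k] nn(1)[of "dy (Suc k)"] nn(2)[of "du (Suc k)"] by linarith
  qed
  have dy0: "dy \<longlonglongrightarrow> 0"
  proof (rule LIMSEQ_imp_Suc, rule tendsto_zero_if_power2_le[OF gap \<kappa>])
    show "\<kappa> * (norm (dy (Suc k)))\<^sup>2 \<le> gap k" for k
      using gap_le[of k] nn(1)[of "r (Suc (Suc k))"] nn(2)[of "du (Suc k)"] by linarith
  qed
  have du0: "du \<longlonglongrightarrow> 0"
  proof (rule LIMSEQ_imp_Suc, rule tendsto_zero_if_power2_le[OF gap m(1)])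
    show "m * (norm (du (Suc k)))\<^sup>2 \<le> gap k" for k
      using gap_le[of k] nn(1)[of "r (Suc (Suc k))"] nn(1)[of "dy (Suc k)"] by linarith
  qed
  have bounded_if: "bounded (range f)"
    if "\<And>k. (norm (f k - c))\<^sup>2 \<le> K * lyapunov \<mu> us ws k" for f :: "nat \<Rightarrow> 'b::real_normed_vector" and c
  proof -
    have "dist c (f k) \<le> sqrt (K * lyapunov \<mu> us ws 0)" for k
    proof -
      have "K * lyapunov \<mu> us ws k \<le> K * lyapunov \<mu> us ws 0"
        using decseqD[OF dec[OF assms], of 0 k] K by (intro mult_left_mono) auto
      with that[of k] show ?thesis
        by (intro real_le_rsqrt) (auto simp: dist_norm norm_minus_commute)
    qed
    then show ?thesis
      by (auto simp: bounded_def)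
  qed
  have "bounded (range (\<lambda>k. u (Suc k)))" "bounded (range (\<lambda>k. w (Suc k)))"
    by (rule bounded_if, rule bd_u, rule bounded_if, rule bd_w)
  \<comment> \<open>Only the pair needs a convergent subsequence: \<open>y\<close> follows it
    because \<open>y k = r k + B (u k)\<close> and the residual vanishes.\<close>
  then have "bounded (range (\<lambda>k. (u (Suc k), w (Suc k))))"
    by (rule bounded_subset[OF bounded_Times]) auto
  from bounded_imp_convergent_subsequence[OF this]
  obtain lim \<rho> where \<rho>: "strict_mono \<rho>"
    and lim: "((\<lambda>k. (u (Suc k), w (Suc k))) \<circ> \<rho>) \<longlonglongrightarrow> lim"
    by blast
  define ui wi where "ui = fst lim" and "wi = snd lim"
  have u_lim: "(\<lambda>k. u (Suc (\<rho> k))) \<longlonglongrightarrow> ui" and w_lim: "(\<lambda>k. w (Suc (\<rho> k))) \<longlonglongrightarrow> wi"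
    using tendsto_fst[OF lim] tendsto_snd[OF lim] by (auto simp: ui_def wi_def o_def)
  have B_lim: "(\<lambda>k. B (f k)) \<longlonglongrightarrow> B a" if "f \<longlonglongrightarrow> a" for f :: "nat \<Rightarrow> 'x" and a
    using bounded_linear.tendsto[OF _ that] B by (simp add: linear_conv_bounded_linear)
  have S_lim: "(\<lambda>k. S (f k)) \<longlonglongrightarrow> S a" if "f \<longlonglongrightarrow> a" for f :: "nat \<Rightarrow> 'x" and a
    using bounded_linear.tendsto[OF _ that] S by (simp add: linear_conv_bounded_linear)
  have T_lim: "(\<lambda>k. T (f k)) \<longlonglongrightarrow> T a" if "f \<longlonglongrightarrow> a" for f :: "nat \<Rightarrow> 'y" and a
    using bounded_linear.tendsto[OF _ that] T by (simp add: linear_conv_bounded_linear)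
  have sub: "(\<lambda>k. f (\<rho> k)) \<longlonglongrightarrow> a" if "f \<longlonglongrightarrow> a" for f :: "nat \<Rightarrow> 'b::topological_space" and a
    using LIMSEQ_subseq_LIMSEQ[OF that \<rho>] by (simp add: o_def)
  have r_sub: "(\<lambda>k. r (Suc (\<rho> k))) \<longlonglongrightarrow> 0"
    by (rule sub) (rule LIMSEQ_Suc[OF r0])
  have y_lim: "(\<lambda>k. y (Suc (\<rho> k))) \<longlonglongrightarrow> B ui"
    using tendsto_add[OF r_sub B_lim[OF u_lim]] by (simp add: r_def)
  \<comment> \<open>The optimality conditions pair \<open>w k\<close> with \<open>y (Suc k)\<close>,
    so the limit of \<open>w\<close> is also needed along the unshifted indices.\<close>
  have w_eq: "w k = w (Suc k) - \<tau> *\<^sub>R r (Suc k)" for k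
    by (simp add: w_step r_def)
  have w_lim': "(\<lambda>k. w (\<rho> k)) \<longlonglongrightarrow> wi"
    using tendsto_diff[OF w_lim tendsto_scaleR[OF tendsto_const r_sub, of \<tau>]]
    by (simp add: w_eq[symmetric])
  have kkt: "kkt ui wi"
    unfolding kkt_def
  proof (intro conjI allI ballI)
    show in_C: "B ui \<in> C"
      by (rule closed_sequentially[OF C _ y_lim]) (rule y_in)
    show "wi \<bullet> B v = 0" for v
    proof -
      \<comment> \<open>In this form everything but \<open>w k\<close> tends to zero along the
        subsequence.\<close>
      have "w k + y k - B (u (Suc k)) = w k + r (Suc k) - dy k" for k
        by (simp add: r_def dy_def)
      then have *: "(w k + r (Suc k) - dy k) \<bullet> B v = S (du k) \<bullet> v" for k
        using u_opt[of k v] by (simp only: du_def)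
      have "(\<lambda>k. (w (\<rho> k) + r (Suc (\<rho> k)) - dy (\<rho> k)) \<bullet> B v) \<longlonglongrightarrow> (wi + 0 - 0) \<bullet> B v"
        by (intro tendsto_intros w_lim' r_sub sub[OF dy0])
      moreover have "(\<lambda>k. S (du (\<rho> k)) \<bullet> v) \<longlonglongrightarrow> S 0 \<bullet> v"
        by (intro tendsto_intros S_lim sub[OF du0])
      ultimately have "(wi + 0 - 0) \<bullet> B v = S 0 \<bullet> v"
        unfolding * by (rule LIMSEQ_unique)
      then show ?thesis
        by (simp add: linear_0[OF S])
    qed
    then have orth: "wi \<bullet> B ui = 0" .
    fix c
    assume c: "c \<in> C"
    have l: "(\<lambda>k. \<phi> (y (Suc (\<rho> k)))) \<longlonglongrightarrow> \<phi> (B ui)"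
      using continuous_on_tendsto_compose[OF \<phi> y_lim in_C] y_in by simp
    have r: "(\<lambda>k. \<phi> c + (w (\<rho> k) + r (Suc (\<rho> k)) + T (dy (\<rho> k))) \<bullet> (c - y (Suc (\<rho> k))))
       \<longlonglongrightarrow> \<phi> c + (wi + 0 + T 0) \<bullet> (c - B ui)"
      by (intro tendsto_intros w_lim' r_sub T_lim sub[OF dy0] y_lim)
    have "\<phi> (y (Suc k)) \<le> \<phi> c + (w k + r (Suc k) + T (dy k)) \<bullet> (c - y (Suc k))" for k
      using y_opt[OF c, of k] by (simp add: r_def dy_def)
    then have "\<phi> (B ui) \<le> \<phi> c + (wi + 0 + T 0) \<bullet> (c - B ui)"
      by (intro LIMSEQ_le[OF l r]) blast
    with orth show "\<phi> (B ui) \<le> \<phi> c + wi \<bullet> c"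
      by (simp add: linear_0[OF T] inner_diff_right)
  qed
  obtain l' where l': "lyapunov \<mu> ui wi \<longlonglongrightarrow> l'"
    using conv[OF kkt] by blast
  \<comment> \<open>With the cluster point as reference every term vanishes along the subsequence.
    As the whole Lyapunov sequence converges, its limit must be zero, and the uniform bounds then
    give convergence of the full iterates.\<close>
  have "(\<lambda>k. lyapunov \<mu> ui wi (\<rho> k)) \<longlonglongrightarrow>
      (norm (wi - wi))\<^sup>2 / \<tau> + (norm (B ui - B ui))\<^sup>2 + (B ui - B ui) \<bullet> T (B ui - B ui)
        + (ui - ui) \<bullet> S (ui - ui) + 0 \<bullet> T 0 + \<mu> * (norm (0::'y))\<^sup>2"
    unfolding lyapunov_def energy_def
    using tau_pos by (intro tendsto_intros T_lim S_lim w_lim y_lim u_lim sub[OF dy0] r_sub) auto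
  from LIMSEQ_unique[OF sub[OF l'] this] have "l' = 0"
    by simp
  then have L0: "(\<lambda>k. K * lyapunov \<mu> ui wi k) \<longlonglongrightarrow> 0"
    using tendsto_mult[OF tendsto_const l', of K] by simp
  have tends: "f \<longlonglongrightarrow> a" if "\<And>k. (norm (f (Suc k) - a))\<^sup>2 \<le> K * lyapunov \<mu> ui wi k"
    for f :: "nat \<Rightarrow> 'b::real_normed_vector" and a
  proof (rule LIMSEQ_imp_Suc, rule LIM_zero_cancel, rule tendsto_zero_if_power2_le[OF L0 zero_less_one])
    show "1 * (norm (f (Suc k) - a))\<^sup>2 \<le> K * lyapunov \<mu> ui wi k" for k
      using that[of k] by simp
  qed
  have "u \<longlonglongrightarrow> ui"
    by (rule tends) (rule bd_u)
  moreover have "y \<longlonglongrightarrow> B ui"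
    by (rule tends) (rule bd_y)
  moreover have "w \<longlonglongrightarrow> wi"
    by (rule tends) (rule bd_w)
  ultimately show ?thesis
    using that[OF kkt] by blast
qed

end

section \<open>Convexity of the smoothed residual\<close>

text \<open>Averaging the affine lower bounds taken at the convex combination \<open>c\<close>
  cancels their linear parts.\<close>

lemma convex_on_if_linear_support:
  fixes f :: "'a::real_vector \<Rightarrow> real"
  assumes A: "convex A"
    and supp: "\<And>a. a \<in> A \<Longrightarrow> \<exists>G. linear G \<and> (\<forall>b\<in>A. f a + G (b - a) \<le> f b)"
  shows "convex_on A f"
proof (rule convex_onI[OF _ A])
  fix t :: real and x y
  assume t: "t > 0" "t < 1" and xy: "x \<in> A" "y \<in> A"
  define c where "c = (1 - t) *\<^sub>R x + t *\<^sub>R y"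
  have "c \<in> A"
    unfolding c_def using convexD_alt[OF A xy] t by simp
  then obtain G where G: "linear G" "\<And>b. b \<in> A \<Longrightarrow> f c + G (b - c) \<le> f b"
    using supp by blast
  have "(1 - t) * (f c + G (x - c)) + t * (f c + G (y - c)) \<le> (1 - t) * f x + t * f y"
    using t xy G(2) by (intro add_mono mult_left_mono) auto
  moreover have "x - c = t *\<^sub>R (x - y)" "y - c = - (1 - t) *\<^sub>R (x - y)"
    by (simp_all add: c_def algebra_simps)
  then have "(1 - t) * (f c + G (x - c)) + t * (f c + G (y - c)) = f c"
    by (simp only: linear_scale[OF G(1)]) (simp add: algebra_simps)
  ultimately show "f ((1 - t) *\<^sub>R x + t *\<^sub>R y) \<le> (1 - t) * f x + t * f y"
    by (simp add: c_def)
qed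

lemma convex_on_linear_vimage:
  assumes h: "linear h" and f: "convex_on A f"
  shows "convex_on (h -` A) (\<lambda>x. f (h x))"
proof (rule convex_onI)
  show "convex (h -` A)"
    using convex_linear_vimage[OF h] f by (simp add: convex_on_def)
  show "f (h ((1 - t) *\<^sub>R x + t *\<^sub>R y)) \<le> (1 - t) * f (h x) + t * f (h y)"
    if "t > 0" "t < 1" "x \<in> h -` A" "y \<in> h -` A" for t x y
    using convex_onD[OF f, of t "h x" "h y"] that by (simp add: linear_add[OF h] linear_scale[OF h])
qed

text \<open>The root is the Euclidean norm of the pair \<open>(a, sqrt \<delta>)\<close>, and the
  claim is the Cauchy-Schwarz inequality for two such pairs.\<close>

lemma smoothed_norm_support_lower:
  fixes a b :: "'a::real_inner"
  assumes "\<delta> > 0"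
  shows "sqrt ((norm a)\<^sup>2 + \<delta>) + a \<bullet> (b - a) / sqrt ((norm a)\<^sup>2 + \<delta>) \<le> sqrt ((norm b)\<^sup>2 + \<delta>)"
proof -
  let ?\<phi> = "\<lambda>x::'a. sqrt ((norm x)\<^sup>2 + \<delta>)"
  have pos: "?\<phi> a > 0"
    using assms by (simp add: add_nonneg_pos)
  have "a \<bullet> b + \<delta> \<le> norm a * norm b + \<delta>"
    by (simp add: norm_cauchy_schwarz)
  also have "\<dots> \<le> sqrt (((norm a)\<^sup>2 + \<delta>) * ((norm b)\<^sup>2 + \<delta>))"
  proof (rule real_le_rsqrt)
    have "0 \<le> \<delta> * (norm a - norm b)\<^sup>2"
      using assms by simp
    then show "(norm a * norm b + \<delta>)\<^sup>2 \<le> ((norm a)\<^sup>2 + \<delta>) * ((norm b)\<^sup>2 + \<delta>)"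
      by (simp add: power2_eq_square algebra_simps)
  qed
  finally have "a \<bullet> b + \<delta> \<le> ?\<phi> a * ?\<phi> b"
    by (simp add: real_sqrt_mult)
  moreover have "?\<phi> a * ?\<phi> a = a \<bullet> a + \<delta>"
    using assms by (simp add: power2_norm_eq_inner)
  ultimately have "?\<phi> a * ?\<phi> a + a \<bullet> (b - a) \<le> ?\<phi> b * ?\<phi> a"
    by (simp add: inner_diff_right mult.commute)
  then show ?thesis
    using pos by (simp add: field_simps)
qed

text \<open>A bound on the curvature: if \<open>P\<close> and \<open>R\<close> are the roots at
  \<open>a\<close> and \<open>b\<close>, then \<open>2 * P * R \<le> P * P + R * R\<close>. Dividing
  by \<open>2 * P\<close> and expanding the squares gives the claim.\<close>

lemma smoothed_norm_support_upper:
  fixes a b :: "'a::real_inner"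
  assumes "\<delta> > 0"
  shows "sqrt ((norm b)\<^sup>2 + \<delta>) \<le> sqrt ((norm a)\<^sup>2 + \<delta>) + a \<bullet> (b - a) / sqrt ((norm a)\<^sup>2 + \<delta>)
    + (norm (b - a))\<^sup>2 / (2 * sqrt ((norm a)\<^sup>2 + \<delta>))"
proof -
  let ?\<phi> = "\<lambda>x::'a. sqrt ((norm x)\<^sup>2 + \<delta>)"
  have pos: "?\<phi> a > 0"
    using assms by (simp add: add_nonneg_pos)
  have sq: "?\<phi> x * ?\<phi> x = x \<bullet> x + \<delta>" for x
    using assms by (simp add: power2_norm_eq_inner)
  have nb: "(norm (b - a))\<^sup>2 = b \<bullet> b - 2 * (a \<bullet> b) + a \<bullet> a"
    by (simp add: power2_norm_eq_inner inner_diff_left inner_diff_right inner_commute)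
  have split: "(2 * (P * P) + 2 * e + n) / (2 * P) = P + e / P + n / (2 * P)" if "P > 0" for P e n :: real
    using that by (simp add: field_simps)
  have arith: "2 * PR \<le> 2 * PP + 2 * (ab - aa) + N"
    if "0 \<le> RR + PP - 2 * PR" "PP = aa + \<delta>" "RR = bb + \<delta>" "N = bb - 2 * ab + aa"
    for PP RR PR aa ab bb N :: real
    using that by (simp add: algebra_simps)
  have "0 \<le> (?\<phi> b - ?\<phi> a)\<^sup>2"
    by simp
  also have "\<dots> = ?\<phi> b * ?\<phi> b + ?\<phi> a * ?\<phi> a - 2 * (?\<phi> a * ?\<phi> b)"
    by (simp add: power2_eq_square algebra_simps)
  finally have "2 * (?\<phi> a * ?\<phi> b) \<le> 2 * (?\<phi> a * ?\<phi> a) + 2 * (a \<bullet> b - a \<bullet> a) + (norm (b - a))\<^sup>2"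
    by (rule arith[OF _ sq sq nb])
  then have "?\<phi> b \<le> (2 * (?\<phi> a * ?\<phi> a) + 2 * (a \<bullet> (b - a)) + (norm (b - a))\<^sup>2) / (2 * ?\<phi> a)"
    using pos by (simp add: pos_le_divide_eq inner_diff_right mult_ac)
  also have "\<dots> = ?\<phi> a + a \<bullet> (b - a) / ?\<phi> a + (norm (b - a))\<^sup>2 / (2 * ?\<phi> a)"
    by (rule split[OF pos])
  finally show ?thesis .
qed

text \<open>After expanding the square, the only possibly concave part is \<open>- 2 * g\<close>
  times the smoothed norm. For \<open>g > 0\<close> its curvature is at most \<open>2 * g\<close>
  over that norm, and \<open>far\<close> lets the quadratic part with factor
  \<open>1 + \<eta>\<close> compensate it.\<close>

lemma convex_on_smoothed_residual:
  fixes c :: "'a::real_inner"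
  assumes \<delta>: "\<delta> > 0" and \<eta>: "\<eta> > 0" and A: "convex A"
    and far: "\<And>x. x \<in> A \<Longrightarrow> g \<le> (1 + \<eta>) * norm x"
  shows "convex_on A (\<lambda>x. (g - sqrt ((norm x)\<^sup>2 + \<delta>))\<^sup>2 + \<eta> * (norm (x - c))\<^sup>2)"
proof (rule convex_on_if_linear_support[OF A])
  fix a
  assume a: "a \<in> A"
  let ?\<phi> = "\<lambda>x::'a. sqrt ((norm x)\<^sup>2 + \<delta>)"
  let ?f = "\<lambda>x. (g - ?\<phi> x)\<^sup>2 + \<eta> * (norm (x - c))\<^sup>2"
  \<comment> \<open>The derivative of \<open>?f\<close> at \<open>a\<close> in direction
    \<open>d\<close>.\<close>
  define G where "G d = 2 * (1 + \<eta>) * (a \<bullet> d) - 2 * g * (a \<bullet> d / ?\<phi> a) - 2 * \<eta> * (c \<bullet> d)" for d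
  have "linear G"
    by (intro linearI) (simp_all add: G_def inner_add_right algebra_simps add_divide_distrib)
  moreover have "?f a + G (b - a) \<le> ?f b" for b
  proof -
    have \<phi>: "?\<phi> a > 0" "norm a \<le> ?\<phi> a"
      using \<delta> by (simp_all add: add_nonneg_pos real_le_rsqrt)
    define e where "e = ?\<phi> b - ?\<phi> a - a \<bullet> (b - a) / ?\<phi> a"
    have e: "0 \<le> e" "e \<le> (norm (b - a))\<^sup>2 / (2 * ?\<phi> a)"
      using smoothed_norm_support_lower[OF \<delta>, of a b] smoothed_norm_support_upper[OF \<delta>, of b a]
      by (simp_all add: e_def)
    have sq: "(?\<phi> x)\<^sup>2 = x \<bullet> x + \<delta>" for x
      using \<delta> by (simp add: power2_norm_eq_inner)
    have "2 * g * e \<le> (1 + \<eta>) * (norm (b - a))\<^sup>2"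
    proof (cases "g \<le> 0")
      case True
      then have "g * e \<le> 0"
        using e(1) by (simp add: mult_nonpos_nonneg)
      moreover have "0 \<le> (1 + \<eta>) * (norm (b - a))\<^sup>2"
        using \<eta> by simp
      ultimately show ?thesis
        by linarith
    next
      case False
      then have "2 * g * e \<le> 2 * g * ((norm (b - a))\<^sup>2 / (2 * ?\<phi> a))"
        using e(2) by (intro mult_left_mono) auto
      also have "\<dots> = g / ?\<phi> a * (norm (b - a))\<^sup>2"
        by simp
      also have "g / ?\<phi> a \<le> 1 + \<eta>"
      proof -
        have "g \<le> (1 + \<eta>) * ?\<phi> a"
          using far[OF a] \<phi>(2) \<eta> by (smt (verit) mult_left_mono)
        then show ?thesis
          using \<phi>(1) by (simp add: pos_divide_le_eq)
      qed
      then have "g / ?\<phi> a * (norm (b - a))\<^sup>2 \<le> (1 + \<eta>) * (norm (b - a))\<^sup>2"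
        by (rule mult_right_mono) simp
      finally show ?thesis .
    qed
    moreover have "?f b - ?f a - G (b - a) = (1 + \<eta>) * (norm (b - a))\<^sup>2 - 2 * g * e"
      unfolding G_def e_def power2_diff sq unfolding power2_norm_eq_inner
      by (simp add: inner_diff_left inner_diff_right inner_commute algebra_simps)
    ultimately show ?thesis
      by linarith
  qed
  ultimately show "\<exists>G. linear G \<and> (\<forall>b\<in>A. ?f a + G (b - a) \<le> ?f b)"
    by blast
qed

lemma convex_on_sq_dist:
  fixes c :: "'a::real_inner"
  assumes "\<eta> > 0" "convex A"
  shows "convex_on A (\<lambda>x. \<eta> * (norm (x - c))\<^sup>2)"
proof (rule convex_on_if_linear_support[OF assms(2)])
  fix a
  have "linear (\<lambda>d. 2 * \<eta> * ((a - c) \<bullet> d))"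
    by (intro linearI) (simp_all add: inner_add_right algebra_simps)
  moreover have "\<eta> * (norm (a - c))\<^sup>2 + 2 * \<eta> * ((a - c) \<bullet> (b - a)) \<le> \<eta> * (norm (b - c))\<^sup>2" for b
  proof -
    have "0 \<le> \<eta> * (norm (b - a))\<^sup>2"
      using assms(1) by simp
    then show ?thesis
      unfolding power2_norm_eq_inner
      by (simp add: inner_diff_left inner_diff_right inner_commute algebra_simps)
  qed
  ultimately show "\<exists>G. linear G \<and> (\<forall>b\<in>A. \<eta> * (norm (a - c))\<^sup>2 + G (b - a) \<le> \<eta> * (norm (b - c))\<^sup>2)"
    by (intro exI[of _ "\<lambda>d. 2 * \<eta> * ((a - c) \<bullet> d)"]) simp
qed

section \<open>Optimality conditions\<close>

text \<open>Compare \<open>x\<close> with the point at parameter \<open>t\<close> on the segment to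
  \<open>c\<close>, bound \<phi> there by convexity, divide by \<open>t\<close> and let
  \<open>t\<close> tend to zero: only the first-order coefficient \<open>G\<close> of
  \<open>q\<close> remains.\<close>

lemma minimizer_variational:
  fixes \<phi> q :: "'a::real_vector \<Rightarrow> real"
  assumes \<phi>: "convex_on C \<phi>" and xc: "x \<in> C" "c \<in> C"
    and min: "\<And>y. y \<in> C \<Longrightarrow> \<phi> x + q x \<le> \<phi> y + q y"
    and q: "\<And>t. q (x + t *\<^sub>R (c - x)) = q x + t * G + t\<^sup>2 * Q"
  shows "\<phi> x \<le> \<phi> c + G"
proof -
  define D where "D = \<phi> c + G - \<phi> x"
  have step: "0 \<le> D + t * Q" if t: "0 < t" "t \<le> 1" for t
  proof -
    have eq: "x + t *\<^sub>R (c - x) = (1 - t) *\<^sub>R x + t *\<^sub>R c"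
      by (simp add: algebra_simps)
    have "x + t *\<^sub>R (c - x) \<in> C"
      unfolding eq using \<phi> xc t by (intro convexD_alt) (auto simp: convex_on_def)
    then have "\<phi> x + q x \<le> \<phi> (x + t *\<^sub>R (c - x)) + q (x + t *\<^sub>R (c - x))"
      by (rule min)
    also have "\<dots> \<le> (1 - t) * \<phi> x + t * \<phi> c + q (x + t *\<^sub>R (c - x))"
      unfolding eq using convex_onD[OF \<phi>, of t x c] t xc by simp
    finally have "0 \<le> t * (D + t * Q)"
      unfolding q by (simp add: D_def algebra_simps power2_eq_square)
    then show ?thesis
      using t by (simp add: zero_le_mult_iff)
  qed
  have "(\<lambda>n. D + inverse (real (Suc n)) * Q) \<longlonglongrightarrow> D + 0 * Q"
    by (intro tendsto_intros LIMSEQ_inverse_real_of_nat)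
  moreover have "0 \<le> D + inverse (real (Suc n)) * Q" for n
    by (rule step) (auto simp: inverse_le_1_iff)
  ultimately have "0 \<le> D + 0 * Q"
    by (intro LIMSEQ_le_const[of "\<lambda>n. D + inverse (real (Suc n)) * Q"]) auto
  then show ?thesis
    by (simp add: D_def)
qed

text \<open>Exact second-order expansion along a line of the smooth part shared by the subproblems;
  symmetry of \<open>S\<close> merges the two mixed terms, whence the factor 2.\<close>

lemma prox_quadratic_expand:
  fixes S :: "'a::real_inner \<Rightarrow> 'a"
  assumes S: "linear S" and sym: "\<And>x y. S x \<bullet> y = x \<bullet> S y"
    and q: "\<And>y. q y = (y - a) \<bullet> w + \<alpha> / 2 * (norm (y - a))\<^sup>2 + (y - b) \<bullet> S (y - b)"
  shows "q (x + t *\<^sub>R d) = q x + t * ((w + \<alpha> *\<^sub>R (x - a) + 2 *\<^sub>R S (x - b)) \<bullet> d)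
     + t\<^sup>2 * (\<alpha> / 2 * (norm d)\<^sup>2 + d \<bullet> S d)"
proof -
  have shift: "x + t *\<^sub>R d - c = (x - c) + t *\<^sub>R d" for c
    by simp
  have "(norm (x - a + t *\<^sub>R d))\<^sup>2 = (norm (x - a))\<^sup>2 + 2 * t * ((x - a) \<bullet> d) + t\<^sup>2 * (norm d)\<^sup>2"
    unfolding power2_norm_eq_inner using inner_commute[of d "x - a"]
    by (simp only: inner_add_left inner_add_right inner_scaleR_left inner_scaleR_right)
      (simp add: power2_eq_square algebra_simps)
  moreover have "(x - b + t *\<^sub>R d) \<bullet> S (x - b + t *\<^sub>R d)
      = (x - b) \<bullet> S (x - b) + 2 * t * (S (x - b) \<bullet> d) + t\<^sup>2 * (d \<bullet> S d)"
    using sym[of "x - b" d] inner_commute[of d "S (x - b)"]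
    by (simp only: linear_add[OF S] linear_scale[OF S] inner_add_left inner_add_right
        inner_scaleR_left inner_scaleR_right) (simp add: power2_eq_square algebra_simps)
  moreover have "(x - a + t *\<^sub>R d) \<bullet> w = (x - a) \<bullet> w + t * (w \<bullet> d)"
    using inner_commute[of d w] by (simp only: inner_add_left inner_scaleR_left)
  ultimately show ?thesis
    unfolding q shift by (simp only: inner_add_left inner_scaleR_left) (simp add: algebra_simps)
qed

lemma prox_step_optimality:
  fixes S :: "'a::real_inner \<Rightarrow> 'a"
  assumes S: "linear S" "\<And>x y. S x \<bullet> y = x \<bullet> S y"
    and \<phi>: "convex_on C \<phi>" and xc: "x \<in> C" "c \<in> C"
    and min: "\<And>y. y \<in> C \<Longrightarrow>
      \<phi> x + ((x - a) \<bullet> w + \<alpha> / 2 * (norm (x - a))\<^sup>2 + (x - b) \<bullet> S (x - b))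
      \<le> \<phi> y + ((y - a) \<bullet> w + \<alpha> / 2 * (norm (y - a))\<^sup>2 + (y - b) \<bullet> S (y - b))"
  shows "\<phi> x \<le> \<phi> c + (w + \<alpha> *\<^sub>R (x - a) + 2 *\<^sub>R S (x - b)) \<bullet> (c - x)"
  by (rule minimizer_variational[OF \<phi> xc min prox_quadratic_expand[OF S]]) auto

text \<open>The minimisation is unconstrained, so the variational inequality applies to both
  \<open>d\<close> and \<open>- d\<close> and becomes an equation.\<close>

lemma linear_step_optimality:
  fixes A :: "'x::real_inner \<Rightarrow> 'y::real_inner" and D :: "'x \<Rightarrow> 'z::real_inner"
  assumes A: "linear A" and D: "linear D"
    and S: "linear S" and S_sym: "\<And>x y. S x \<bullet> y = x \<bullet> S y"
    and min: "\<And>v. (z - A x) \<bullet> w + (p - D x) \<bullet> q + \<alpha> / 2 * (norm (z - A x))\<^sup>2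
        + \<gamma> / 2 * (norm (p - D x))\<^sup>2 + (x - x0) \<bullet> S (x - x0)
      \<le> (z - A v) \<bullet> w + (p - D v) \<bullet> q + \<alpha> / 2 * (norm (z - A v))\<^sup>2
        + \<gamma> / 2 * (norm (p - D v))\<^sup>2 + (v - x0) \<bullet> S (v - x0)"
  shows "(w + \<alpha> *\<^sub>R (z - A x)) \<bullet> A d + (q + \<gamma> *\<^sub>R (p - D x)) \<bullet> D d = 2 * (S (x - x0) \<bullet> d)"
proof -
  \<comment> \<open>The objective is a sum of three instances of the same quadratic, composed with
    \<open>A\<close>, \<open>D\<close> and the identity. The multipliers change sign because the
    differences are reversed.\<close>
  define Q1 where "Q1 y = (y - z) \<bullet> (- w) + \<alpha> / 2 * (norm (y - z))\<^sup>2 + (y - z) \<bullet> 0" for y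
  define Q2 where "Q2 r = (r - p) \<bullet> (- q) + \<gamma> / 2 * (norm (r - p))\<^sup>2 + (r - p) \<bullet> 0" for r
  define Q3 where "Q3 v = (v - x0) \<bullet> 0 + 0 / 2 * (norm (v - x0))\<^sup>2 + (v - x0) \<bullet> S (v - x0)" for v
  note E1 = prox_quadratic_expand[of "\<lambda>_. 0" Q1, OF linear_zero _ Q1_def]
  note E2 = prox_quadratic_expand[of "\<lambda>_. 0" Q2, OF linear_zero _ Q2_def]
  note E3 = prox_quadratic_expand[of S Q3, OF S S_sym Q3_def]
  define q' where "q' v = Q1 (A v) + Q2 (D v) + Q3 v" for v
  define G where "G d = (- w + \<alpha> *\<^sub>R (A x - z)) \<bullet> A d + (- q + \<gamma> *\<^sub>R (D x - p)) \<bullet> D d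
    + 2 * (S (x - x0) \<bullet> d)" for d
  have q': "q' v = (z - A v) \<bullet> w + (p - D v) \<bullet> q + \<alpha> / 2 * (norm (z - A v))\<^sup>2
        + \<gamma> / 2 * (norm (p - D v))\<^sup>2 + (v - x0) \<bullet> S (v - x0)" for v
    by (simp add: q'_def Q1_def Q2_def Q3_def inner_diff_left norm_minus_commute)
  have "(0::real) \<le> 0 + G d" for d
  proof (rule minimizer_variational[where C = UNIV and \<phi> = "\<lambda>_. 0" and x = x and c = "x + d" and q = q'
        and Q = "\<alpha> / 2 * (norm (A d))\<^sup>2 + \<gamma> / 2 * (norm (D d))\<^sup>2 + d \<bullet> S d"])
    show "convex_on UNIV (\<lambda>_::'x. 0::real)"
      by (simp add: convex_on_def)
    show "0 + q' x \<le> 0 + q' y" for y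
      unfolding q' using min by simp
    show "q' (x + t *\<^sub>R (x + d - x)) = q' x + t * G d
        + t\<^sup>2 * (\<alpha> / 2 * (norm (A d))\<^sup>2 + \<gamma> / 2 * (norm (D d))\<^sup>2 + d \<bullet> S d)" for t
      unfolding q'_def G_def
      by (simp add: linear_add[OF A] linear_scale[OF A] linear_add[OF D] linear_scale[OF D] E1 E2 E3)
        (simp add: algebra_simps)
  qed auto
  from this[of d] this[of "- d"] have "G d = 0"
    by (simp add: G_def linear_neg[OF A] linear_neg[OF D])
  then show ?thesis
    by (simp add: G_def inner_add_left inner_diff_left algebra_simps)
qed

text \<open>Passes between the optimality condition of one block and its scaled form: the first
  factor is multiplied by \<open>a\<close> and the second divided by it, which accounts for the
  multiplier \<open>w /\<^sub>R a\<close> and the proximal weight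
  \<open>2 / \<alpha>\<close>.\<close>

lemma rescale_inner:
  fixes T :: "'a::real_inner \<Rightarrow> 'a"
  assumes T: "linear T" and a: "a > 0" "a * a = \<alpha>"
  shows "(w /\<^sub>R a + (a *\<^sub>R x - a *\<^sub>R m) + (2 / \<alpha>) *\<^sub>R T (a *\<^sub>R x - a *\<^sub>R b)) \<bullet> (c - a *\<^sub>R x)
    = (w + \<alpha> *\<^sub>R (x - m) + 2 *\<^sub>R T (x - b)) \<bullet> (c /\<^sub>R a - x)"
proof -
  have "a *\<^sub>R (w /\<^sub>R a + (a *\<^sub>R x - a *\<^sub>R m) + (2 / \<alpha>) *\<^sub>R T (a *\<^sub>R x - a *\<^sub>R b))
      = w + \<alpha> *\<^sub>R (x - m) + 2 *\<^sub>R T (x - b)"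
    unfolding a(2)[symmetric] using a(1)
    by (simp add: linear_scale[OF T] algebra_simps flip: scaleR_diff_right)
  moreover have "c - a *\<^sub>R x = a *\<^sub>R (c /\<^sub>R a - x)"
    using a by (simp add: algebra_simps)
  ultimately show ?thesis
    by (metis inner_scaleR_left inner_scaleR_right)
qed

text \<open>A hyperplane separates the strict epigraph from the range at height \<open>?m\<close>.
  Its horizontal part annihilates the range, its vertical part is positive by the Slater condition,
  and their quotient is the multiplier.\<close>

lemma exists_lagrange_multiplier:
  fixes B :: "'x::real_vector \<Rightarrow> 'y::euclidean_space"
  assumes B: "linear B" and \<phi>: "convex_on C \<phi>"
    and us: "B us \<in> C" "\<And>v. B v \<in> C \<Longrightarrow> \<phi> (B us) \<le> \<phi> (B v)"
    and slater: "B u0 \<in> interior C"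
  obtains w where "\<And>v. w \<bullet> B v = 0" "\<And>c. c \<in> C \<Longrightarrow> \<phi> (B us) \<le> \<phi> c + w \<bullet> c"
proof -
  let ?m = "\<phi> (B us)"
  define E1 where "E1 = {(c, t). c \<in> C \<and> \<phi> c < t}"
  define E2 where "E2 = range B \<times> {?m}"
  have "convex E1"
  proof (rule convexI)
    fix p q and a b :: real
    assume pq: "p \<in> E1" "q \<in> E1" and ab: "0 \<le> a" "0 \<le> b" "a + b = 1"
    obtain c t d t' where p: "p = (c, t)" "c \<in> C" "\<phi> c < t" and q: "q = (d, t')" "d \<in> C" "\<phi> d < t'"
      using pq by (auto simp: E1_def)
    have "\<phi> (a *\<^sub>R c + b *\<^sub>R d) \<le> a * \<phi> c + b * \<phi> d" "a *\<^sub>R c + b *\<^sub>R d \<in> C"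
      using \<phi> p q ab by (auto simp: convex_on_def convex_def)
    moreover have "a * \<phi> c + b * \<phi> d < a * t + b * t'"
    proof (cases "a = 0")
      case False
      then have "a * \<phi> c < a * t" "b * \<phi> d \<le> b * t'"
        using p q ab by (auto intro: mult_left_mono)
      then show ?thesis by linarith
    qed (use ab q in auto)
    ultimately show "a *\<^sub>R p + b *\<^sub>R q \<in> E1"
      by (simp add: E1_def p q)
  qed
  moreover have "convex E2"
    unfolding E2_def
    by (intro convex_Times subspace_imp_convex[OF linear_subspace_image[OF B subspace_UNIV]]) simp
  moreover have "(B us, ?m + 1) \<in> E1" "(B us, ?m) \<in> E2"
    using us by (auto simp: E1_def E2_def)
  moreover have "E1 \<inter> E2 = {}"
    using us(2) by (fastforce simp: E1_def E2_def)
  ultimately obtain n \<theta> where n: "n \<noteq> 0" "\<forall>x\<in>E2. n \<bullet> x \<le> \<theta>" "\<forall>x\<in>E1. n \<bullet> x \<ge> \<theta>"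
    using separating_hyperplane_sets[of E2 E1] by blast
  define y \<beta> where "y = fst n" and "\<beta> = snd n"
  have E1: "\<theta> \<le> y \<bullet> c + \<beta> * t" if "c \<in> C" "\<phi> c < t" for c t
    using n(3) that by (auto simp: E1_def y_def \<beta>_def inner_prod_def)
  have E2: "y \<bullet> B v + \<beta> * ?m \<le> \<theta>" for v
    using n(2) by (auto simp: E2_def y_def \<beta>_def inner_prod_def)
  \<comment> \<open>A linear functional bounded above on a subspace vanishes there; otherwise the
    multiple of \<open>v\<close> chosen below overshoots \<theta> by 1.\<close>
  have orth: "y \<bullet> B v = 0" for v
  proof (rule ccontr)
    assume "y \<bullet> B v \<noteq> 0"
    then show False
      using E2[of "((\<theta> - \<beta> * ?m + 1) / (y \<bullet> B v)) *\<^sub>R v"] by (simp add: linear_scale[OF B])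
  qed
  have \<theta>: "\<beta> * ?m \<le> \<theta>"
    using E2[of 0] by (simp add: linear_0[OF B])
  have "\<beta> \<ge> 0"
    using E1[OF us(1), of "?m + 1"] orth \<theta> by (simp add: algebra_simps)
  moreover have "\<beta> \<noteq> 0"
  proof
    assume \<beta>: "\<beta> = 0"
    have y: "y \<noteq> 0"
      using n(1) \<beta> by (auto simp: y_def \<beta>_def prod_eq_iff)
    obtain e where e: "e > 0" "cball (B u0) e \<subseteq> C"
      using slater unfolding mem_interior_cball by blast
    \<comment> \<open>A vertical hyperplane would make \<open>y\<close> nonnegative on
      \<open>C\<close>, yet moving from the Slater point against \<open>y\<close> stays in
      \<open>C\<close> and makes it negative.\<close>
    have "B u0 - (e / norm y) *\<^sub>R y \<in> C"
      using e y by (intro subsetD[OF e(2)]) (simp add: dist_norm)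
    from E1[OF this, of "\<phi> (B u0 - (e / norm y) *\<^sub>R y) + 1"] have "e / norm y * (y \<bullet> y) \<le> 0"
      using \<beta> \<theta> orth[of u0] by (simp add: inner_diff_right)
    then show False
      using e(1) y by (simp add: mult_le_0_iff divide_le_0_iff inner_gt_zero_iff flip: not_less)
  qed
  ultimately have \<beta>: "\<beta> > 0"
    by simp
  show ?thesis
  proof (rule that[of "y /\<^sub>R \<beta>"])
    show "(y /\<^sub>R \<beta>) \<bullet> B v = 0" for v
      by (simp add: orth)
    fix c
    assume c: "c \<in> C"
    show "?m \<le> \<phi> c + (y /\<^sub>R \<beta>) \<bullet> c"
    \<comment> \<open>The epigraph is strict, so the separation applies only at heights
      \<open>\<phi> c + e\<close>.\<close>
    proof (rule field_le_epsilon)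
      fix e :: real
      assume "e > 0"
      then have "\<beta> * ?m \<le> y \<bullet> c + \<beta> * (\<phi> c + e)"
        using E1[OF c, of "\<phi> c + e"] \<theta> by simp
      then show "?m \<le> \<phi> c + (y /\<^sub>R \<beta>) \<bullet> c + e"
        using \<beta> by (simp add: field_simps)
    qed
  qed
qed

text \<open>The range of \<open>B\<close> is a closed subspace, so its part of a sublevel set fits
  into a compact set. Minimising over the values \<open>B v\<close> requires a bound on these only,
  not on \<open>v\<close>.\<close>

lemma exists_minimizer_on_range:
  fixes B :: "'x::real_vector \<Rightarrow> 'y::euclidean_space" and \<phi> :: "'y \<Rightarrow> real"
  assumes B: "linear B" and C: "closed C" and \<phi>: "continuous_on C \<phi>" and v0: "B v0 \<in> C"
    and bdd: "bounded {c \<in> C. \<phi> c \<le> \<phi> (B v0)}"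
  obtains us where "B us \<in> C" "\<And>v. B v \<in> C \<Longrightarrow> \<phi> (B us) \<le> \<phi> (B v)"
proof -
  obtain M where M: "\<And>c. c \<in> C \<Longrightarrow> \<phi> c \<le> \<phi> (B v0) \<Longrightarrow> norm c \<le> M"
    using bdd unfolding bounded_iff by blast
  let ?K = "C \<inter> range B \<inter> cball 0 M"
  have "compact ?K"
    using C by (intro closed_Int_compact closed_Int compact_cball
        closed_subspace[OF linear_subspace_image[OF B subspace_UNIV]])
  moreover have "B v0 \<in> ?K"
    using v0 M[OF v0 order_refl] by simp
  moreover have "continuous_on ?K \<phi>"
    using \<phi> by (rule continuous_on_subset) blast
  ultimately obtain x where x: "x \<in> ?K" "\<And>c. c \<in> ?K \<Longrightarrow> \<phi> x \<le> \<phi> c"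
    using continuous_attains_inf[of ?K \<phi>] by blast
  then obtain us where us: "x = B us"
    by blast
  have "\<phi> x \<le> \<phi> (B v)" if v: "B v \<in> C" for v
  proof (cases "\<phi> (B v) \<le> \<phi> (B v0)")
    case True
    then show ?thesis
      using M[OF v] v by (intro x(2)) auto
  next
    case False
    then show ?thesis
      using x(2)[OF \<open>B v0 \<in> ?K\<close>] by linarith
  qed
  with x(1) us show ?thesis
    by (intro that[of us]) auto
qed

section \<open>The cost and the feasible set\<close>

text \<open>Lets the complex problem be treated as one over the underlying real Euclidean
  space.\<close>

lemma Re_cinner: "Re (cinner x y) = x \<bullet> y"
  by (simp add: cinner_def inner_vec_def inner_complex_def)

lemma seminorm_sq_eq_inner: "seminorm_sq S x = x \<bullet> S x"
  by (simp add: seminorm_sq_def Re_cinner)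

lemma complex_linear_imp_linear:
  assumes "complex_linear T"
  shows "linear T"
proof -
  interpret Vector_Spaces.linear "(*s)" "(*s)" T
    using assms by (simp add: complex_linear_def)
  have scaleR: "r *\<^sub>R x = complex_of_real r *s x" for r and x :: "complex ^ 'i::finite"
    by (simp add: vec_eq_iff complex_eq_iff)
  show ?thesis
    by (intro linearI) (simp_all add: add scale scaleR)
qed

lemma self_adjointD:
  assumes "self_adjoint S"
  shows "linear S" "S x \<bullet> y = x \<bullet> S y"
  using assms by (auto simp: self_adjoint_def complex_linear_imp_linear simp flip: Re_cinner)

lemma linear_grad: "linear grad"
  by (intro linearI)
    (auto simp: grad_def grad_x_def grad_y_def vec_eq_iff algebra_simps split: sum.splits)

lemma l1_norm_scaleR: "l1_norm (r *\<^sub>R x) = \<bar>r\<bar> * l1_norm x"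
  by (simp add: l1_norm_def sum_distrib_left)

lemma l1_norm_triangle: "l1_norm (x + y) \<le> l1_norm x + l1_norm y"
  unfolding l1_norm_def sum.distrib[symmetric] by (intro sum_mono) (simp add: norm_triangle_ineq)

lemma norm_le_l1_norm: "norm x \<le> l1_norm x"
  unfolding norm_vec_def l1_norm_def by (rule L2_set_le_sum) simp

lemma convex_on_l1_norm:
  assumes "lam \<ge> 0"
  shows "convex_on UNIV (\<lambda>x. lam * l1_norm x)"
proof (rule convex_onI)
  fix t :: real and x y :: "complex ^ 'i"
  assume "t > 0" "t < 1"
  then have "l1_norm ((1 - t) *\<^sub>R x + t *\<^sub>R y) \<le> (1 - t) * l1_norm x + t * l1_norm y"
    using l1_norm_triangle[of "(1 - t) *\<^sub>R x" "t *\<^sub>R y"] by (simp add: l1_norm_scaleR)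
  from mult_left_mono[OF this assms]
  show "lam * l1_norm ((1 - t) *\<^sub>R x + t *\<^sub>R y) \<le> (1 - t) * (lam * l1_norm x) + t * (lam * l1_norm y)"
    by (simp add: algebra_simps)
qed simp

lemma continuous_l1_norm: "continuous_on A l1_norm"
  unfolding l1_norm_def by (intro continuous_intros)

text \<open>The finite part of \<open>z_cost\<close>. Together with its effective domain
  \<open>z_feasible\<close> it replaces the extended-valued cost by a real function on a closed
  convex set.\<close>

definition z_obj ::
  "'i::finite set \<Rightarrow> ('i \<Rightarrow> real) \<Rightarrow> ('i \<Rightarrow> real) \<Rightarrow> real \<Rightarrow> complex ^ 'i \<Rightarrow> complex ^ 'i \<Rightarrow> real"
  where
  "z_obj \<Gamma> g \<delta> \<eta> zhat z = (\<Sum>j\<in>\<Gamma>. (g j - sqrt ((cmod (z $ j))\<^sup>2 + \<delta> j))\<^sup>2)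
     + \<eta> * (\<Sum>j\<in>UNIV. (cmod (z $ j - zhat $ j))\<^sup>2)"

definition z_feasible ::
  "'i::finite set \<Rightarrow> ('i \<Rightarrow> real) \<Rightarrow> ('i \<Rightarrow> real) \<Rightarrow> real \<Rightarrow> complex ^ 'i \<Rightarrow> (complex ^ 'i) set" where
  "z_feasible \<Gamma> g s \<eta> zhat = {z. \<forall>j\<in>\<Gamma>. z $ j \<in> half_plane \<eta> (g j) (s j) (zhat $ j)}"

lemma z_cost_eq:
  "z_cost \<Gamma> g \<delta> s \<eta> zhat z =
     (if z \<in> z_feasible \<Gamma> g s \<eta> zhat then ereal (z_obj \<Gamma> g \<delta> \<eta> zhat z) else \<infinity>)"
proof (cases "z \<in> z_feasible \<Gamma> g s \<eta> zhat")
  case True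
  then have "(\<Sum>j\<in>\<Gamma>. cvx_indicator (half_plane \<eta> (g j) (s j) (zhat $ j)) (z $ j)) = 0"
    by (intro sum.neutral) (simp add: z_feasible_def cvx_indicator_def)
  with True show ?thesis
    by (simp add: z_cost_def z_obj_def)
next
  case False
  then obtain j where j: "j \<in> \<Gamma>" "z $ j \<notin> half_plane \<eta> (g j) (s j) (zhat $ j)"
    by (auto simp: z_feasible_def)
  have "(\<Sum>j\<in>\<Gamma>. cvx_indicator (half_plane \<eta> (g j) (s j) (zhat $ j)) (z $ j)) = \<infinity>"
    using j by (auto simp: sum_Pinfty cvx_indicator_def)
  with False show ?thesis
    by (simp add: z_cost_def)
qed

text \<open>A feasible point makes the minimal value finite, which forces the minimiser into the
  effective domain, where the comparison is one of real numbers.\<close>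

lemma is_arg_min_z_cost:
  assumes min: "is_arg_min (\<lambda>y. z_cost \<Gamma> g \<delta> s \<eta> zhat y + ereal (q y)) (\<lambda>_. True) x"
    and z0: "z0 \<in> z_feasible \<Gamma> g s \<eta> zhat"
  shows "x \<in> z_feasible \<Gamma> g s \<eta> zhat"
    and "y \<in> z_feasible \<Gamma> g s \<eta> zhat \<Longrightarrow> z_obj \<Gamma> g \<delta> \<eta> zhat x + q x \<le> z_obj \<Gamma> g \<delta> \<eta> zhat y + q y"
proof -
  have le: "z_cost \<Gamma> g \<delta> s \<eta> zhat x + ereal (q x) \<le> z_cost \<Gamma> g \<delta> s \<eta> zhat y + ereal (q y)" for y
    using min by (auto simp: is_arg_min_def not_less)
  show x: "x \<in> z_feasible \<Gamma> g s \<eta> zhat"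
    using le[of z0] z0 by (auto simp: z_cost_eq split: if_splits)
  show "z_obj \<Gamma> g \<delta> \<eta> zhat x + q x \<le> z_obj \<Gamma> g \<delta> \<eta> zhat y + q y"
    if "y \<in> z_feasible \<Gamma> g s \<eta> zhat"
    using le[of y] x that by (simp add: z_cost_eq)
qed

section \<open>Half-planes, the feasible set and a Slater point\<close>

lemma inner_normalized_self:
  fixes x :: "'a::real_inner"
  shows "inverse (norm x) * (x \<bullet> x) = norm x"
  by (cases "x = 0") (simp_all add: power2_norm_eq_inner[symmetric] power2_eq_square)

lemma half_plane_eq:
  "half_plane \<eta> g s zh = (if g \<le> 0 then UNIV else {\<zeta>. radius \<eta> g + s \<le> (zh /\<^sub>R cmod zh) \<bullet> \<zeta>})"
proof -
  have "(zh /\<^sub>R cmod zh) \<bullet> \<zeta> = Re (\<zeta> * cnj zh) / cmod zh" for \<zeta>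
    by (simp only: inner_scaleR_left) (simp add: inner_complex_def divide_inverse mult_ac)
  then show ?thesis
    by (simp only: half_plane_def)
qed

lemma convex_half_plane: "convex (half_plane \<eta> g s zh)"
  by (simp add: half_plane_eq convex_halfspace_ge del: inner_scaleR_left)

lemma closed_half_plane: "closed (half_plane \<eta> g s zh)"
  by (simp add: half_plane_eq closed_halfspace_ge del: inner_scaleR_left)

text \<open>Points of the half-plane have modulus at least the radius by Cauchy-Schwarz, and
  \<open>2 / sqrt 3 \<ge> 1\<close>. This supplies the hypothesis \<open>far\<close> of the
  convexity lemma.\<close>

lemma half_plane_far:
  assumes "\<eta> > 0" "g > 0 \<Longrightarrow> s \<ge> 0" "\<zeta> \<in> half_plane \<eta> g s zh"
  shows "g \<le> (1 + \<eta>) * cmod \<zeta>"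
proof (cases "g \<le> 0")
  case True
  then show ?thesis
    using assms(1) by (meson add_nonneg_nonneg less_imp_le mult_nonneg_nonneg norm_ge_zero order_trans zero_le_one)
next
  case False
  have "radius \<eta> g \<le> (zh /\<^sub>R cmod zh) \<bullet> \<zeta>"
    using assms False by (simp add: half_plane_eq)
  also have "\<dots> \<le> norm (zh /\<^sub>R cmod zh) * cmod \<zeta>"
    by (rule norm_cauchy_schwarz)
  also have "\<dots> \<le> 1 * cmod \<zeta>"
    by (intro mult_right_mono) (cases "zh = 0", auto)
  finally have "(1 + \<eta>) * radius \<eta> g \<le> (1 + \<eta>) * cmod \<zeta>"
    using assms(1) by simp
  moreover have "(1 + \<eta>) * radius \<eta> g = g * (2 / sqrt 3)"
    using assms(1) by (simp add: radius_def divide_simps)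
  moreover have "1 \<le> 2 / sqrt 3"
    by (simp add: real_le_lsqrt)
  then have "g * 1 \<le> g * (2 / sqrt 3)"
    using False by (intro mult_left_mono) auto
  ultimately show ?thesis
    by linarith
qed

lemma convex_z_feasible: "convex (z_feasible \<Gamma> g s \<eta> zhat)"
proof -
  have "z_feasible \<Gamma> g s \<eta> zhat
      = (\<Inter>j\<in>\<Gamma>. (\<lambda>z. z $ j) -` half_plane \<eta> (g j) (s j) (zhat $ j))"
    by (auto simp: z_feasible_def)
  then show ?thesis
    by (auto intro!: convex_INT convex_linear_vimage convex_half_plane
        bounded_linear.linear[OF bounded_linear_vec_nth])
qed

lemma closed_z_feasible: "closed (z_feasible \<Gamma> g s \<eta> zhat)"
proof -
  have "z_feasible \<Gamma> g s \<eta> zhat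
      = (\<Inter>j\<in>\<Gamma>. (\<lambda>z. z $ j) -` half_plane \<eta> (g j) (s j) (zhat $ j))"
    by (auto simp: z_feasible_def)
  then show ?thesis
    by (auto intro!: closed_INT continuous_closed_vimage closed_half_plane continuous_intros)
qed

lemma convex_on_z_obj:
  assumes \<delta>: "\<And>j. j \<in> \<Gamma> \<Longrightarrow> \<delta> j > 0" and \<eta>: "\<eta> > 0"
    and s: "\<And>j. j \<in> \<Gamma> \<Longrightarrow> g j > 0 \<Longrightarrow> s j \<ge> 0"
  shows "convex_on (z_feasible \<Gamma> g s \<eta> zhat) (z_obj \<Gamma> g \<delta> \<eta> zhat)"
proof (rule convex_onI[OF _ convex_z_feasible])
  fix t :: real and x y
  assume t: "t > 0" "t < 1" and xy: "x \<in> z_feasible \<Gamma> g s \<eta> zhat" "y \<in> z_feasible \<Gamma> g s \<eta> zhat"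
  \<comment> \<open>The objective separates over the coordinates; those outside
    \<open>\<Gamma>\<close> carry only the quadratic.\<close>
  define f where "f j \<zeta> = (if j \<in> \<Gamma> then (g j - sqrt ((cmod \<zeta>)\<^sup>2 + \<delta> j))\<^sup>2 else 0)
    + \<eta> * (cmod (\<zeta> - zhat $ j))\<^sup>2" for j \<zeta>
  have obj: "z_obj \<Gamma> g \<delta> \<eta> zhat z = (\<Sum>j\<in>UNIV. f j (z $ j))" for z
    by (simp add: z_obj_def f_def sum.distrib sum_distrib_left sum.If_cases)
  have "f j ((1 - t) *\<^sub>R x $ j + t *\<^sub>R y $ j) \<le> (1 - t) * f j (x $ j) + t * f j (y $ j)" for j
  proof (cases "j \<in> \<Gamma>")
    case True
    then have "convex_on (half_plane \<eta> (g j) (s j) (zhat $ j)) (f j)"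
      unfolding f_def using convex_on_smoothed_residual[OF \<delta>[OF True] \<eta> convex_half_plane]
        half_plane_far[OF \<eta> s[OF True]] by simp
    then show ?thesis
      using convex_onD[of _ "f j" t "x $ j" "y $ j"] xy t True by (simp add: z_feasible_def)
  next
    case False
    then have "convex_on UNIV (f j)"
      unfolding f_def using convex_on_sq_dist[OF \<eta>, of UNIV] by simp
    then show ?thesis
      using convex_onD[of _ "f j" t "x $ j" "y $ j"] t by simp
  qed
  then have "z_obj \<Gamma> g \<delta> \<eta> zhat ((1 - t) *\<^sub>R x + t *\<^sub>R y)
      \<le> (\<Sum>j\<in>UNIV. (1 - t) * f j (x $ j) + t * f j (y $ j))"
    unfolding obj by (intro sum_mono) simp
  then show "z_obj \<Gamma> g \<delta> \<eta> zhat ((1 - t) *\<^sub>R x + t *\<^sub>R y)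
      \<le> (1 - t) * z_obj \<Gamma> g \<delta> \<eta> zhat x + t * z_obj \<Gamma> g \<delta> \<eta> zhat y"
    by (simp add: obj sum.distrib sum_distrib_left)
qed

lemma continuous_z_obj: "continuous_on A (z_obj \<Gamma> g \<delta> \<eta> zhat)"
  unfolding z_obj_def by (intro continuous_intros)

lemma z_obj_coercive:
  assumes "\<eta> \<ge> 0"
  shows "\<eta> * (norm (z - zhat))\<^sup>2 \<le> z_obj \<Gamma> g \<delta> \<eta> zhat z"
proof -
  have "(norm (z - zhat))\<^sup>2 = (\<Sum>j\<in>UNIV. (cmod (z $ j - zhat $ j))\<^sup>2)"
    by (simp add: norm_vec_def L2_set_def sum_nonneg)
  then show ?thesis
    by (simp add: z_obj_def sum_nonneg)
qed

lemma z_feasible_zhat: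
  assumes "\<And>j. j \<in> \<Gamma> \<Longrightarrow> g j > 0 \<Longrightarrow> s j \<le> cmod (zhat $ j) - radius \<eta> (g j)"
  shows "zhat \<in> z_feasible \<Gamma> g s \<eta> zhat"
proof -
  have "radius \<eta> (g j) + s j \<le> (zhat $ j /\<^sub>R cmod (zhat $ j)) \<bullet> zhat $ j" if "j \<in> \<Gamma>" "g j > 0" for j
    using assms[OF that] by (simp add: inner_normalized_self)
  then show ?thesis
    by (force simp: z_feasible_def half_plane_eq)
qed

text \<open>Doubling \<open>zhat\<close> moves it off the bounding lines, since these do not pass through the origin.\<close>

lemma slater_point:
  assumes \<eta>: "\<eta> > 0"
    and s: "\<And>j. j \<in> \<Gamma> \<Longrightarrow> g j > 0 \<Longrightarrow> s j \<le> cmod (zhat $ j) - radius \<eta> (g j)"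
    and out: "\<And>j. j \<in> \<Gamma> \<Longrightarrow> g j > 0 \<Longrightarrow> cmod (zhat $ j) > radius \<eta> (g j)"
  shows "2 *\<^sub>R zhat \<in> interior (z_feasible \<Gamma> g s \<eta> zhat)"
proof (rule interiorI)
  let ?U = "\<Inter>j\<in>{j\<in>\<Gamma>. g j > 0}. {z. radius \<eta> (g j) + s j < (zhat $ j /\<^sub>R cmod (zhat $ j)) \<bullet> z $ j}"
  show "open ?U"
    by (intro open_INT ballI open_Collect_less continuous_intros) simp
  show "?U \<subseteq> z_feasible \<Gamma> g s \<eta> zhat"
    by (force simp: z_feasible_def half_plane_eq)
  \<comment> \<open>The left-hand side is at most \<open>cmod (zhat $ j)\<close>, which is positive,
    while the right-hand side is twice that.\<close>
  have "radius \<eta> (g j) + s j < 2 * ((zhat $ j /\<^sub>R cmod (zhat $ j)) \<bullet> zhat $ j)" if "j \<in> \<Gamma>" "g j > 0" for j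
  proof -
    have "radius \<eta> (g j) > 0"
      using \<eta> that by (simp add: radius_def)
    with s[OF that] out[OF that] show ?thesis
      by (simp add: inner_normalized_self)
  qed
  then show "2 *\<^sub>R zhat \<in> ?U"
    by (auto simp: mult.left_commute[of _ 2])
qed

section \<open>The imaging problem\<close>

theorem theorem4p2:
  fixes A :: "complex ^ ('r::{finite,linorder} \<times> 'c::{finite,linorder}) \<Rightarrow> complex ^ ('j::finite \<times> 'r \<times> 'c)"
    and \<Gamma> :: "('j \<times> 'r \<times> 'c) set"
    and g \<delta> s :: "'j \<times> 'r \<times> 'c \<Rightarrow> real"
    and lam \<eta> \<alpha> \<gamma> \<tau> :: real
    and uhat :: "complex ^ ('r \<times> 'c)"
    and zhat :: "complex ^ ('j \<times> 'r \<times> 'c)"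
    and S1 :: "complex ^ ('r \<times> 'c) \<Rightarrow> complex ^ ('r \<times> 'c)"
    and S2 :: "complex ^ ('j \<times> 'r \<times> 'c) \<Rightarrow> complex ^ ('j \<times> 'r \<times> 'c)"
    and S3 :: "complex ^ ('r \<times> 'c + 'r \<times> 'c) \<Rightarrow> complex ^ ('r \<times> 'c + 'r \<times> 'c)"
    and u :: "nat \<Rightarrow> complex ^ ('r \<times> 'c)"
    and z w :: "nat \<Rightarrow> complex ^ ('j \<times> 'r \<times> 'c)"
    and p q :: "nat \<Rightarrow> complex ^ ('r \<times> 'c + 'r \<times> 'c)"
  assumes A: "complex_linear A"
    and \<delta>: "\<And>j. j \<in> \<Gamma> \<Longrightarrow> \<delta> j > 0"
    and lam: "lam > 0" and \<eta>: "\<eta> > 0"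
    and zhat: "zhat = A uhat"
    and outside: "\<And>j. j \<in> \<Gamma> \<Longrightarrow> g j > 0 \<Longrightarrow> cmod (zhat $ j) > radius \<eta> (g j)"
    and shift: "\<And>j. j \<in> \<Gamma> \<Longrightarrow> g j > 0 \<Longrightarrow> 0 \<le> s j \<and> s j \<le> cmod (zhat $ j) - radius \<eta> (g j)"
    and \<alpha>: "\<alpha> > 0" and \<gamma>: "\<gamma> > 0"
    and S1: "pos_semidef S1" and S2: "pos_semidef S2" and S3: "pos_semidef S3"
    and u_step: "\<And>k. is_arg_min
          (\<lambda>v. Re (cinner (z k - A v) (w k)) + Re (cinner (p k - grad v) (q k))
             + \<alpha> / 2 * (norm (z k - A v))\<^sup>2 + \<gamma> / 2 * (norm (p k - grad v))\<^sup>2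
             + seminorm_sq S1 (v - u k))
          (\<lambda>_. True) (u (Suc k))"
    and z_step: "\<And>k. is_arg_min
          (\<lambda>y. z_cost \<Gamma> g \<delta> s \<eta> zhat y
             + ereal (Re (cinner (y - A (u (Suc k))) (w k))
                + \<alpha> / 2 * (norm (y - A (u (Suc k))))\<^sup>2
                + seminorm_sq S2 (y - z k)))
          (\<lambda>_. True) (z (Suc k))"
    and p_step: "\<And>k. is_arg_min
          (\<lambda>r. lam * l1_norm r + Re (cinner (r - grad (u (Suc k))) (q k))
             + \<gamma> / 2 * (norm (r - grad (u (Suc k))))\<^sup>2
             + seminorm_sq S3 (r - p k))
          (\<lambda>_. True) (p (Suc k))"
    and w_step: "\<And>k. w (Suc k) = w k + (\<tau> * \<alpha>) *\<^sub>R (z (Suc k) - A (u (Suc k)))"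
    and q_step: "\<And>k. q (Suc k) = q k + (\<tau> * \<gamma>) *\<^sub>R (p (Suc k) - grad (u (Suc k)))"
    and S1_pos: "pos_def S1"
    and \<tau>: "\<tau> \<in> {0<..<(1 + sqrt 5) / 2}"
  shows "\<exists>uinf zinf pinf winf qinf.
      (\<lambda>k. (u k, z k, p k, w k, q k)) \<longlonglongrightarrow> (uinf, zinf, pinf, winf, qinf) \<and>
      is_arg_min (\<lambda>(v, y, r). ereal (lam * l1_norm r) + z_cost \<Gamma> g \<delta> s \<eta> zhat y)
        (\<lambda>(v, y, r). y = A v \<and> r = grad v) (uinf, zinf, pinf)"
proof -

  \<comment> \<open>Scaled variables and the data of the abstract scheme\<close>
  define a b where "a = sqrt \<alpha>" and "b = sqrt \<gamma>"
  have a: "a > 0" "a * a = \<alpha>" and b: "b > 0" "b * b = \<gamma>"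
    using \<alpha> \<gamma> by (auto simp: a_def b_def)
  have cancel: "a * (inverse a * x) = x" "b * (inverse b * x) = x" "inverse a * (a * x) = x" for x
    using a(1) b(1) by (simp_all add: mult.assoc[symmetric])
  let ?K = "z_feasible \<Gamma> g s \<eta> zhat" and ?f = "z_obj \<Gamma> g \<delta> \<eta> zhat"
  \<comment> \<open>Scaling the blocks by \<open>a\<close> and \<open>b\<close> makes both penalties
    1, and the multipliers are divided accordingly. The 2 in \<open>S\<close> and \<open>T\<close>
    comes from differentiating the proximal terms.\<close>
  define B where "B v = (a *\<^sub>R A v, b *\<^sub>R grad v)" for v
  define S where "S v = 2 *\<^sub>R S1 v" for v
  define T where "T y = ((2 / \<alpha>) *\<^sub>R S2 (fst y), (2 / \<gamma>) *\<^sub>R S3 (snd y))" for y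
  define C where "C = (\<lambda>y :: (complex ^ ('j \<times> 'r \<times> 'c)) \<times> (complex ^ ('r \<times> 'c + 'r \<times> 'c)). fst y /\<^sub>R a) -` ?K"
  define \<phi> where "\<phi> y = ?f (fst y /\<^sub>R a) + lam * l1_norm (snd y /\<^sub>R b)"
    for y :: "(complex ^ ('j \<times> 'r \<times> 'c)) \<times> (complex ^ ('r \<times> 'c + 'r \<times> 'c))"
  define Y where "Y k = (a *\<^sub>R z k, b *\<^sub>R p k)" for k
  define W where "W k = (w k /\<^sub>R a, q k /\<^sub>R b)" for k
  have lin: "linear A" "linear S1" "linear S2" "linear S3"
    using A S1 S2 S3 by (auto simp: complex_linear_imp_linear pos_semidef_def self_adjointD)
  have sym: "S1 v \<bullet> v' = v \<bullet> S1 v'" "S2 y \<bullet> y' = y \<bullet> S2 y'" "S3 r \<bullet> r' = r \<bullet> S3 r'"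
    for v v' y y' r r'
    using S1 S2 S3 by (auto simp: pos_semidef_def self_adjointD)
  have linB: "linear B"
    by (intro linearI) (simp_all add: B_def linear_add linear_scale lin linear_grad scaleR_add_right)
  have sge: "\<And>j. j \<in> \<Gamma> \<Longrightarrow> g j > 0 \<Longrightarrow> s j \<ge> 0"
    and sle: "\<And>j. j \<in> \<Gamma> \<Longrightarrow> g j > 0 \<Longrightarrow> s j \<le> cmod (zhat $ j) - radius \<eta> (g j)"
    using shift by auto
  have cvx_f: "convex_on ?K ?f"
    by (rule convex_on_z_obj[OF \<delta> \<eta> sge])
  have cvx_l1: "convex_on UNIV (\<lambda>r :: complex ^ ('r \<times> 'c + 'r \<times> 'c). lam * l1_norm r)"
    using lam by (intro convex_on_l1_norm) simp
  have zhat_K: "zhat \<in> ?K"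
    by (rule z_feasible_zhat[OF sle])
  have lin_fst: "linear (\<lambda>y :: (complex ^ ('j \<times> 'r \<times> 'c)) \<times> (complex ^ ('r \<times> 'c + 'r \<times> 'c)). fst y /\<^sub>R a)"
    and lin_snd: "linear (\<lambda>y :: (complex ^ ('j \<times> 'r \<times> 'c)) \<times> (complex ^ ('r \<times> 'c + 'r \<times> 'c)). snd y /\<^sub>R b)"
    by (intro linearI; simp add: scaleR_add_right)+
  have C_convex: "convex C"
    unfolding C_def by (intro convex_linear_vimage lin_fst convex_z_feasible)
  have C_closed: "closed C"
    unfolding C_def by (intro continuous_closed_vimage closed_z_feasible continuous_intros)
  have \<phi>_convex: "convex_on C \<phi>"
    unfolding \<phi>_def
  proof (rule convex_on_add)
    show "convex_on C (\<lambda>y. ?f (fst y /\<^sub>R a))"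
      unfolding C_def by (rule convex_on_linear_vimage[OF lin_fst cvx_f])
    show "convex_on C (\<lambda>y. lam * l1_norm (snd y /\<^sub>R b))"
      using convex_on_linear_vimage[OF lin_snd cvx_l1]
      by (rule convex_on_subset) (auto simp: C_convex)
  qed
  have \<phi>_cont: "continuous_on C \<phi>"
    unfolding \<phi>_def
    by (intro continuous_intros continuous_on_compose2[OF continuous_z_obj[of UNIV]]
        continuous_on_compose2[OF continuous_l1_norm[of UNIV]]) auto

  \<comment> \<open>Optimality conditions of the three minimisation steps\<close>
  have z_K: "z (Suc k) \<in> ?K" for k
    by (rule is_arg_min_z_cost(1)[OF z_step zhat_K])
  have z_vi: "?f (z (Suc k)) \<le> ?f c + (w k + \<alpha> *\<^sub>R (z (Suc k) - A (u (Suc k)))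
      + 2 *\<^sub>R S2 (z (Suc k) - z k)) \<bullet> (c - z (Suc k))" if "c \<in> ?K" for k c
  proof (rule prox_step_optimality[OF lin(3) sym(2) cvx_f z_K that])
    fix y
    assume "y \<in> ?K"
    from is_arg_min_z_cost(2)[OF z_step zhat_K this, of k]
    show "?f (z (Suc k)) + ((z (Suc k) - A (u (Suc k))) \<bullet> w k
        + \<alpha> / 2 * (norm (z (Suc k) - A (u (Suc k))))\<^sup>2 + (z (Suc k) - z k) \<bullet> S2 (z (Suc k) - z k))
      \<le> ?f y + ((y - A (u (Suc k))) \<bullet> w k + \<alpha> / 2 * (norm (y - A (u (Suc k))))\<^sup>2
        + (y - z k) \<bullet> S2 (y - z k))"
      by (simp only: Re_cinner seminorm_sq_eq_inner)
  qed
  have p_vi: "lam * l1_norm (p (Suc k)) \<le> lam * l1_norm c + (q k + \<gamma> *\<^sub>R (p (Suc k) - grad (u (Suc k)))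
      + 2 *\<^sub>R S3 (p (Suc k) - p k)) \<bullet> (c - p (Suc k))" for k c
  proof (rule prox_step_optimality[OF lin(4) sym(3) cvx_l1 UNIV_I UNIV_I])
    fix r
    show "lam * l1_norm (p (Suc k)) + ((p (Suc k) - grad (u (Suc k))) \<bullet> q k
        + \<gamma> / 2 * (norm (p (Suc k) - grad (u (Suc k))))\<^sup>2 + (p (Suc k) - p k) \<bullet> S3 (p (Suc k) - p k))
      \<le> lam * l1_norm r + ((r - grad (u (Suc k))) \<bullet> q k + \<gamma> / 2 * (norm (r - grad (u (Suc k))))\<^sup>2
        + (r - p k) \<bullet> S3 (r - p k))"
      using p_step[of k] by (simp add: is_arg_min_def not_less Re_cinner seminorm_sq_eq_inner add.assoc)
  qed
  have u_vi: "(w k + \<alpha> *\<^sub>R (z k - A (u (Suc k)))) \<bullet> A v + (q k + \<gamma> *\<^sub>R (p k - grad (u (Suc k)))) \<bullet> grad v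
      = 2 * (S1 (u (Suc k) - u k) \<bullet> v)" for k v
    using u_step[of k]
    by (intro linear_step_optimality lin linear_grad sym)
      (simp add: is_arg_min_def not_less Re_cinner seminorm_sq_eq_inner)
  interpret semi_proximal_admm B S T C \<phi> u Y W \<tau>
  proof (rule semi_proximal_admm.intro)
    show "linear S" "linear T"
      by (intro linearI; simp add: S_def T_def linear_add linear_scale lin scaleR_add_right)+
    show "S v \<bullet> v' = v \<bullet> S v'" for v v'
      by (simp add: S_def sym)
    show "0 < v \<bullet> S v" if "v \<noteq> 0" for v
      using S1_pos that by (simp add: S_def pos_def_def Re_cinner)
    show "T y \<bullet> y' = y \<bullet> T y'" for y y'
      by (simp add: T_def inner_prod_def sym)
    show "0 \<le> y \<bullet> T y" for y
      using S2 S3 \<alpha> \<gamma> by (simp add: T_def inner_prod_def pos_semidef_def Re_cinner)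
    show "(W k + Y k - B (u (Suc k))) \<bullet> B v = S (u (Suc k) - u k) \<bullet> v" for k v
    proof -
      have "(W k + Y k - B (u (Suc k))) \<bullet> B v = (w k + \<alpha> *\<^sub>R (z k - A (u (Suc k)))) \<bullet> A v
          + (q k + \<gamma> *\<^sub>R (p k - grad (u (Suc k)))) \<bullet> grad v"
        by (simp add: W_def Y_def B_def cancel inner_add_left inner_diff_left algebra_simps flip: a(2) b(2))
      then show ?thesis
        using u_vi by (simp add: S_def)
    qed
    show "Y (Suc k) \<in> C" for k
      using z_K a by (simp add: Y_def C_def)
    show "\<phi> (Y (Suc k)) \<le> \<phi> c + (W k + (Y (Suc k) - B (u (Suc k))) + T (Y (Suc k) - Y k)) \<bullet> (c - Y (Suc k))"
      if "c \<in> C" for k c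
    proof -
      have eq: "(W k + (Y (Suc k) - B (u (Suc k))) + T (Y (Suc k) - Y k)) \<bullet> (c - Y (Suc k))
        = (w k + \<alpha> *\<^sub>R (z (Suc k) - A (u (Suc k))) + 2 *\<^sub>R S2 (z (Suc k) - z k)) \<bullet> (fst c /\<^sub>R a - z (Suc k))
          + (q k + \<gamma> *\<^sub>R (p (Suc k) - grad (u (Suc k))) + 2 *\<^sub>R S3 (p (Suc k) - p k))
            \<bullet> (snd c /\<^sub>R b - p (Suc k))"
        unfolding rescale_inner[OF lin(3) a, symmetric] rescale_inner[OF lin(4) b, symmetric]
        by (simp only: W_def Y_def B_def T_def inner_prod_def fst_add snd_add fst_diff snd_diff fst_conv snd_conv)
      have \<phi>Y: "\<phi> (Y (Suc k)) = ?f (z (Suc k)) + lam * l1_norm (p (Suc k))"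
        using a b by (simp add: \<phi>_def Y_def)
      have mem: "fst c /\<^sub>R a \<in> ?K"
        using that by (simp add: C_def)
      from add_mono[OF z_vi[OF mem, of k] p_vi[of k "snd c /\<^sub>R b"]] show ?thesis
        unfolding eq \<phi>Y \<phi>_def[of c] by (simp only: add_ac)
    qed
    show "W (Suc k) = W k + \<tau> *\<^sub>R (Y (Suc k) - B (u (Suc k)))" for k
      using a b
      by (simp add: W_def Y_def B_def w_step q_step algebra_simps flip: a(2) b(2))
  qed (fact linB C_closed \<phi>_cont \<tau>)+

  \<comment> \<open>Existence of a KKT point\<close>
  have B_uhat: "B uhat \<in> C" and slater: "B (2 *\<^sub>R uhat) \<in> interior C"
  proof -
    show "B uhat \<in> C"
      using zhat_K a by (simp add: B_def C_def zhat)
    show "B (2 *\<^sub>R uhat) \<in> interior C"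
    proof (rule interiorI)
      let ?U = "(\<lambda>y :: (complex ^ ('j \<times> 'r \<times> 'c)) \<times> (complex ^ ('r \<times> 'c + 'r \<times> 'c)). fst y /\<^sub>R a) -` interior ?K"
      show "open ?U"
        by (intro open_vimage continuous_intros) auto
      show "B (2 *\<^sub>R uhat) \<in> ?U"
      proof -
        have "2 *\<^sub>R zhat \<in> interior ?K"
          by (rule slater_point[OF \<eta> sle outside])
        then show ?thesis
          by (simp add: B_def linear_scale[OF lin(1)] zhat cancel)
      qed
      show "?U \<subseteq> C"
        unfolding C_def using interior_subset by blast
    qed
  qed
  have "bounded {c \<in> C. \<phi> c \<le> \<phi> (B uhat)}"
  proof -
    let ?M = "\<phi> (B uhat)"
    \<comment> \<open>Both parts of \<phi> are nonnegative, so each is bounded by the level: the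
      first grows quadratically around \<open>zhat\<close>, the second at least linearly.\<close>
    have "norm (fst c /\<^sub>R a - zhat) \<le> sqrt (?M / \<eta>) \<and> norm (snd c /\<^sub>R b) \<le> ?M / lam"
      if "\<phi> c \<le> ?M" for c
    proof -
      have 1: "\<eta> * (norm (fst c /\<^sub>R a - zhat))\<^sup>2 \<le> ?f (fst c /\<^sub>R a)"
        using \<eta> by (intro z_obj_coercive) simp
      have 2: "lam * norm (snd c /\<^sub>R b) \<le> lam * l1_norm (snd c /\<^sub>R b)"
        using lam by (intro mult_left_mono norm_le_l1_norm) simp
      have "0 \<le> \<eta> * (norm (fst c /\<^sub>R a - zhat))\<^sup>2" "0 \<le> lam * norm (snd c /\<^sub>R b)"
        using \<eta> lam by auto
      with 1 2 that have "\<eta> * (norm (fst c /\<^sub>R a - zhat))\<^sup>2 \<le> ?M" "lam * norm (snd c /\<^sub>R b) \<le> ?M"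
        unfolding \<phi>_def[of c] by linarith+
      then show ?thesis
        using \<eta> lam by (intro conjI real_le_rsqrt) (simp_all add: pos_le_divide_eq mult.commute)
    qed
    note * = this
    have sub: "{c \<in> C. \<phi> c \<le> ?M}
      \<subseteq> (\<lambda>y. (a *\<^sub>R fst y, b *\<^sub>R snd y)) ` (cball zhat (sqrt (?M / \<eta>)) \<times> cball 0 (?M / lam))"
    proof
      fix c
      assume "c \<in> {c \<in> C. \<phi> c \<le> ?M}"
      then show "c \<in> (\<lambda>y. (a *\<^sub>R fst y, b *\<^sub>R snd y)) `
          (cball zhat (sqrt (?M / \<eta>)) \<times> cball 0 (?M / lam))"
        using *[of c] a(1) b(1)
        by (intro image_eqI[of _ _ "(fst c /\<^sub>R a, snd c /\<^sub>R b)"]) (auto simp: dist_norm norm_minus_commute)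
    qed
    have blin: "bounded_linear (\<lambda>y :: (complex ^ ('j \<times> 'r \<times> 'c)) \<times> (complex ^ ('r \<times> 'c + 'r \<times> 'c)). (a *\<^sub>R fst y, b *\<^sub>R snd y))"
      unfolding linear_conv_bounded_linear[symmetric] by (intro linearI) (simp_all add: scaleR_add_right)
    show ?thesis
      by (rule bounded_subset[OF bounded_linear_image[OF bounded_Times[OF bounded_cball bounded_cball] blin] sub])
  qed
  from exists_minimizer_on_range[OF linB C_closed \<phi>_cont B_uhat this]
  obtain us where us: "B us \<in> C" "\<And>v. B v \<in> C \<Longrightarrow> \<phi> (B us) \<le> \<phi> (B v)"
    by blast
  have "\<exists>ws. kkt us ws"
  proof (rule exists_lagrange_multiplier[OF linB \<phi>_convex us slater])
    fix ws
    assume "\<And>v. ws \<bullet> B v = 0" "\<And>c. c \<in> C \<Longrightarrow> \<phi> (B us) \<le> \<phi> c + ws \<bullet> c"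
    with us(1) have "kkt us ws"
      by (simp add: kkt_def)
    then show ?thesis ..
  qed
  then obtain ui wi where kkt: "kkt ui wi" and lim: "u \<longlonglongrightarrow> ui" "Y \<longlonglongrightarrow> B ui" "W \<longlonglongrightarrow> wi"
    using converges_to_kkt by blast
  \<comment> \<open>The multiplier term of the KKT inequality vanishes at \<open>c = B v\<close>,
    which leaves optimality among the feasible points.\<close>
  have opt: "A ui \<in> ?K" "A v \<in> ?K \<Longrightarrow> ?f (A ui) + lam * l1_norm (grad ui) \<le> ?f (A v) + lam * l1_norm (grad v)" for v
  proof -
    have *: "B v \<in> C \<longleftrightarrow> A v \<in> ?K" "\<phi> (B v) = ?f (A v) + lam * l1_norm (grad v)" for v
      using a b by (simp_all add: B_def C_def \<phi>_def)
    show "A ui \<in> ?K"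
      using kkt * by (simp add: kkt_def)
    show "?f (A ui) + lam * l1_norm (grad ui) \<le> ?f (A v) + lam * l1_norm (grad v)" if "A v \<in> ?K"
      using kkt that unfolding kkt_def *[symmetric] by (metis add.right_neutral)
  qed
  \<comment> \<open>Undoing the scaling recovers the limits of the original sequences.\<close>
  have "(\<lambda>k. fst (Y k) /\<^sub>R a) \<longlonglongrightarrow> fst (B ui) /\<^sub>R a" "(\<lambda>k. snd (Y k) /\<^sub>R b) \<longlonglongrightarrow> snd (B ui) /\<^sub>R b"
    "(\<lambda>k. a *\<^sub>R fst (W k)) \<longlonglongrightarrow> a *\<^sub>R fst wi" "(\<lambda>k. b *\<^sub>R snd (W k)) \<longlonglongrightarrow> b *\<^sub>R snd wi"
    by (intro tendsto_intros lim)+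
  then have "z \<longlonglongrightarrow> A ui" "p \<longlonglongrightarrow> grad ui" "w \<longlonglongrightarrow> a *\<^sub>R fst wi" "q \<longlonglongrightarrow> b *\<^sub>R snd wi"
    using a(1) b(1) by (simp_all add: Y_def W_def B_def)
  with lim(1) have "(\<lambda>k. (u k, z k, p k, w k, q k)) \<longlonglongrightarrow> (ui, A ui, grad ui, a *\<^sub>R fst wi, b *\<^sub>R snd wi)"
    by (intro tendsto_Pair)
  moreover have "is_arg_min (\<lambda>(v, y, r). ereal (lam * l1_norm r) + z_cost \<Gamma> g \<delta> s \<eta> zhat y)
        (\<lambda>(v, y, r). y = A v \<and> r = grad v) (ui, A ui, grad ui)"
    using opt by (auto simp: is_arg_min_def z_cost_eq not_less add.commute)
  ultimately show ?thesis
    by blast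
qed

end
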